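(* Let $\mathbb X$ be a complete separable metric space and let $\eta_1=\sum_{i=1}^{\tau}\delta_{X_i}$ be a mixed sampled point process on $\mathbb X$ for which $\tau\in\mathcal S$. Then $\eta_1<_{dcx}\eta_2$, where $\eta_2$ denotes a Poisson point process on $\mathbb X$ with intensity measure $\mathbb E\eta_1$.
   Context: Mixed sampled point process: $(X_i)_{i\ge1}$ is an i.i.d. sequence of random elements of $\mathbb X$ with common distribution $F$, $\tau$ is a random variable with values in $\{0,1,2,\dots\}$ independent of $(X_i)_{i\ge 1}$, and $\eta_1=\sum_{i=1}^{\tau}\delta_{X_i}$, where $\delta_x$ is the Dirac measure at $x$. $\mathbb E\eta_1$ denotes the measure $B\mapsto\mathbb E[\eta_1(B)]$. Class $\mathcal S$: a finite sequence $(a_i)_{i=0}^n$ of non-negative reals with no internal zeros (the indices of its non-zero terms form a discrete interval) is ultra log-concave, ULC$(n)$, if $\left(a_i/\binom ni\right)^2\ge \frac{a_{i-1}}{\binom n{i-1}}\cdot\frac{a_{i+1}}{\binom n{i+1}}$ for $i=1,\dots,n-1$. $\mathcal S_n$ is the class of (distributions of) random variables $\tau$ with values in $\{0,\dots,n\}$ such that $(\mathbb P(\tau=i))_{i=0}^n$ is ULC$(n)$. $\mathcal S$ is the weak closure of $\bigcup_{n\ge1}\mathcal S_n$, i.e. the class of all probability distributions on $\{0,1,2,\dots\}$ that are weak limits of distributions from $\bigcup_n\mathcal S_n$. One writes $\tau\in\mathcal S$ if the distribution of $\tau$ belongs to $\mathcal S$. Order: for $f:\mathbb R^n\to\mathbb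 R$ and $\epsilon>0$ put $\Delta_i^{\epsilon}f(\mathbf x)=f(\mathbf x+\epsilon \mathbf e_i)-f(\mathbf x)$, $\mathbf e_i$ the $i$-th unit vector. $f$ is directionally convex if $\Delta_j^{\delta}\Delta_i^{\epsilon}f(\mathbf x)\ge0$ for all $1\le i\le j\le n$, $\epsilon,\delta>0$, $\mathbf x\in\mathbb R^n$. For random vectors, $\mathbf X<_{dcx}\mathbf Y$ means $\mathbb Ef(\mathbf X)\le\mathbb Ef(\mathbf Y)$ for all directionally convex $f$ for which the expectations exist. For point processes on $\mathbb X$, $\eta_1<_{dcx}\eta_2$ means $(\eta_1(B_1),\dots,\eta_1(B_n))<_{dcx}(\eta_2(B_1),\dots,\eta_2(B_n))$ for all $n\ge1$ and all disjoint bounded Borel sets $B_1,\dots,B_n$. *)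

theory Defs
  imports "HOL-Probability.Probability"
begin

section \<open>The class \<open>S\<close>\<close>

definition no_internal_zeros :: "nat \<Rightarrow> (nat \<Rightarrow> real) \<Rightarrow> bool" where
  "no_internal_zeros n a \<longleftrightarrow>
     (\<forall>i j k. i < j \<and> j < k \<and> k \<le> n \<and> a i \<noteq> 0 \<and> a k \<noteq> 0 \<longrightarrow> a j \<noteq> 0)"

definition ULC :: "nat \<Rightarrow> (nat \<Rightarrow> real) \<Rightarrow> bool" where
  "ULC n a \<longleftrightarrow>
     (\<forall>i\<le>n. 0 \<le> a i) \<and> no_internal_zeros n a \<and>
     (\<forall>i. 1 \<le> i \<and> i < n \<longrightarrow>
        (a i / real (n choose i))\<^sup>2
          \<ge> (a (i - 1) / real (n choose (i - 1))) * (a (i + 1) / real (n choose (i + 1))))"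

definition ULC_pmfs :: "nat \<Rightarrow> nat pmf set" where
  "ULC_pmfs n = {p. set_pmf p \<subseteq> {..n} \<and> ULC n (pmf p)}"

text \<open>The library's weak convergence is for measures on the Borel sets of the real line, so
  distributions on the natural numbers are pushed forward along \<^term>\<open>real\<close>. Weak convergence is
  metrizable, hence the closure consists of the limits of sequences.\<close>

definition class_S :: "nat pmf set" where
  "class_S = {p. \<exists>q :: nat \<Rightarrow> nat pmf. (\<forall>k. q k \<in> (\<Union>n\<in>{1..}. ULC_pmfs n)) \<and>
     weak_conv_m (\<lambda>k. distr (measure_pmf (q k)) borel real) (distr (measure_pmf p) borel real)}"

definition in_class_S :: "'w measure \<Rightarrow> ('w \<Rightarrow> nat) \<Rightarrow> bool" where
  "in_class_S M \<tau> \<longleftrightarrow> (\<exists>p\<in>class_S. distr M (count_space UNIV) \<tau> = measure_pmf p)"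

section \<open>The directionally convex order\<close>

text \<open>Vectors of length \<open>n\<close> are the elements of \<^term>\<open>PiE {..<n} (\<lambda>_. UNIV :: real set)\<close>.\<close>

definition diff_op :: "nat \<Rightarrow> real \<Rightarrow> ((nat \<Rightarrow> real) \<Rightarrow> real) \<Rightarrow> (nat \<Rightarrow> real) \<Rightarrow> real" where
  "diff_op i \<epsilon> f x = f (x(i := x i + \<epsilon>)) - f x"

definition directionally_convex :: "nat \<Rightarrow> ((nat \<Rightarrow> real) \<Rightarrow> real) \<Rightarrow> bool" where
  "directionally_convex n f \<longleftrightarrow>
     (\<forall>x \<in> PiE {..<n} (\<lambda>_. UNIV). \<forall>i j. i \<le> j \<and> j < n \<longrightarrow>
        (\<forall>\<epsilon>>0. \<forall>\<delta>>0. 0 \<le> diff_op j \<delta> (diff_op i \<epsilon> f) x))"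

text \<open>An expectation exists if the positive or the negative part has finite integral; its value is
  then an extended real. Integrable functions are the case where the value is finite.\<close>

definition expectation_exists :: "'w measure \<Rightarrow> ('w \<Rightarrow> real) \<Rightarrow> bool" where
  "expectation_exists M g \<longleftrightarrow> g \<in> borel_measurable M \<and>
     ((\<integral>\<^sup>+\<omega>. ennreal (g \<omega>) \<partial>M) < \<infinity> \<or> (\<integral>\<^sup>+\<omega>. ennreal (- g \<omega>) \<partial>M) < \<infinity>)"

definition ext_expectation :: "'w measure \<Rightarrow> ('w \<Rightarrow> real) \<Rightarrow> ereal" where
  "ext_expectation M g =
     enn2ereal (\<integral>\<^sup>+\<omega>. ennreal (g \<omega>) \<partial>M) - enn2ereal (\<integral>\<^sup>+\<omega>. ennreal (- g \<omega>) \<partial>M)"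

definition dcx_le ::
  "nat \<Rightarrow> 'w measure \<Rightarrow> ('w \<Rightarrow> nat \<Rightarrow> real) \<Rightarrow> 'v measure \<Rightarrow> ('v \<Rightarrow> nat \<Rightarrow> real) \<Rightarrow> bool" where
  "dcx_le n M X N Y \<longleftrightarrow>
     (\<forall>f. directionally_convex n f \<and>
          expectation_exists M (\<lambda>\<omega>. f (X \<omega>)) \<and> expectation_exists N (\<lambda>\<omega>. f (Y \<omega>)) \<longrightarrow>
          ext_expectation M (\<lambda>\<omega>. f (X \<omega>)) \<le> ext_expectation N (\<lambda>\<omega>. f (Y \<omega>)))"

definition count_vector ::
  "nat \<Rightarrow> (nat \<Rightarrow> 'a set) \<Rightarrow> ('w \<Rightarrow> 'a measure) \<Rightarrow> 'w \<Rightarrow> nat \<Rightarrow> real" where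
  "count_vector n B \<eta> \<omega> = (\<lambda>i\<in>{..<n}. measure (\<eta> \<omega>) (B i))"

definition disjoint_bounded_borel :: "nat \<Rightarrow> (nat \<Rightarrow> 'a::metric_space set) \<Rightarrow> bool" where
  "disjoint_bounded_borel n B \<longleftrightarrow>
     (\<forall>i<n. B i \<in> sets borel \<and> bounded (B i)) \<and> disjoint_family_on B {..<n}"

definition dcx_le_pp ::
  "'w measure \<Rightarrow> ('w \<Rightarrow> 'a::metric_space measure) \<Rightarrow>
   'v measure \<Rightarrow> ('v \<Rightarrow> 'a measure) \<Rightarrow> bool" where
  "dcx_le_pp M \<eta>\<^sub>1 N \<eta>\<^sub>2 \<longleftrightarrow>
     (\<forall>n\<ge>1. \<forall>B. disjoint_bounded_borel n B \<longrightarrow>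
        dcx_le n M (count_vector n B \<eta>\<^sub>1) N (count_vector n B \<eta>\<^sub>2))"

section \<open>Point processes\<close>

definition point_process :: "'w measure \<Rightarrow> ('w \<Rightarrow> 'a::metric_space measure) \<Rightarrow> bool" where
  "point_process M \<eta> \<longleftrightarrow>
     (\<forall>\<omega>\<in>space M. sets (\<eta> \<omega>) = sets borel \<and>
        (\<forall>B\<in>sets borel. bounded B \<longrightarrow> emeasure (\<eta> \<omega>) B \<in> range of_nat)) \<and>
     (\<forall>B\<in>sets borel. (\<lambda>\<omega>. emeasure (\<eta> \<omega>) B) \<in> borel_measurable M)"

definition mean_measure :: "'w measure \<Rightarrow> ('w \<Rightarrow> 'a::metric_space measure) \<Rightarrow> 'a measure" where
  "mean_measure M \<eta> = measure_of UNIV (sets borel) (\<lambda>B. \<integral>\<^sup>+\<omega>. emeasure (\<eta> \<omega>) B \<partial>M)"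

text \<open>The distribution of the counts is spelled out instead of using \<^const>\<open>poisson_pmf\<close>, which does
  not cover the rate \<open>0\<close>.\<close>

definition poisson_point_process ::
  "'w measure \<Rightarrow> 'a::metric_space measure \<Rightarrow> ('w \<Rightarrow> 'a measure) \<Rightarrow> bool" where
  "poisson_point_process M \<Lambda> \<eta> \<longleftrightarrow>
     point_process M \<eta> \<and> sets \<Lambda> = sets borel \<and>
     (\<forall>B\<in>sets borel. bounded B \<longrightarrow> emeasure \<Lambda> B < \<infinity> \<and>
        (\<forall>k::nat. measure M {\<omega>\<in>space M. emeasure (\<eta> \<omega>) B = of_nat k}
           = measure \<Lambda> B ^ k / fact k * exp (- measure \<Lambda> B))) \<and>
     (\<forall>n B. disjoint_bounded_borel n B \<longrightarrow>
        prob_space.indep_vars M (\<lambda>_. borel) (\<lambda>i \<omega>. emeasure (\<eta> \<omega>) (B i)) {..<n})"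

text \<open>The sum \<open>\<delta>\<^bsub>X\<^sub>1\<^esub> + \<dots> + \<delta>\<^bsub>X\<^sub>\<tau>\<^esub>\<close>, with the sequence indexed from \<open>0\<close>;
  \<^term>\<open>return borel x\<close> is the Dirac measure at \<open>x\<close>.\<close>

definition sampled_process ::
  "('w \<Rightarrow> nat) \<Rightarrow> (nat \<Rightarrow> 'w \<Rightarrow> 'a::metric_space) \<Rightarrow> 'w \<Rightarrow> 'a measure" where
  "sampled_process \<tau> X \<omega> =
     measure_of UNIV (sets borel) (\<lambda>B. \<Sum>i<\<tau> \<omega>. emeasure (return borel (X i \<omega>)) B)"

text \<open>\<^const>\<open>prob_space.indep_var\<close> relates variables of one type only, so the independence of \<open>\<tau>\<close>
  and the whole sequence is stated for the generated sigma-algebras.\<close>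

definition mixed_sampled_point_process ::
  "'w measure \<Rightarrow> 'a::metric_space measure \<Rightarrow> ('w \<Rightarrow> nat) \<Rightarrow> (nat \<Rightarrow> 'w \<Rightarrow> 'a) \<Rightarrow>
   ('w \<Rightarrow> 'a measure) \<Rightarrow> bool" where
  "mixed_sampled_point_process M F \<tau> X \<eta> \<longleftrightarrow>
     prob_space.indep_vars M (\<lambda>_. borel) X UNIV \<and>
     (\<forall>i. distr M borel (X i) = F) \<and>
     \<tau> \<in> measurable M (count_space UNIV) \<and>
     prob_space.indep_set M
       (sets (vimage_algebra (space M) \<tau> (count_space UNIV)))
       (sets (vimage_algebra (space M) (\<lambda>\<omega> i. X i \<omega>) (PiM UNIV (\<lambda>_. borel)))) \<and>
     \<eta> = sampled_process \<tau> X"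

end

theory Submission
  imports Defs
begin

text \<open>
  The number of points of the sampled process is compared first. For \<open>\<tau>\<close> with distribution in
  \<open>S\<close>, the sequence \<open>k! P(\<tau> = k)\<close> is log-concave without internal zeros
  (\<open>class_S_log_concave\<close>): ultra log-concavity implies this for each approximating distribution, and
  the property passes to weak limits. So the likelihood ratio of \<open>\<tau>\<close> with respect to the Poisson
  distribution with the same mean \<open>r\<close> is log-concave, the difference of the two distributions changes
  sign at most twice, and \<open>\<tau>\<close> is smaller than the Poisson variable in the convex order
  (\<open>log_concave_convex_le_poisson\<close>).

  The spatial structure enters through a convex function of the number of points. Disjoint sets
  \<open>B\<^sub>0, \<dots>, B\<^sub>n\<^sub>-\<^sub>1\<close>, together with their joint complement, divide the space into cells. Given \<open>\<tau> = k\<close>,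
  the cell counts are obtained by throwing \<open>k\<close> independent points into the cells, so the expectation
  of \<open>u\<close> of the counts is \<open>g k = (T ^ k) u 0\<close>, where \<open>T\<close> averages \<open>u\<close> over the position of one additional point
  (\<open>expectation_mixed_occupancy\<close>). The second difference of \<open>g\<close> is a non-negative combination of
  second differences \<open>\<Delta>\<^sub>i \<Delta>\<^sub>j u\<close>, so \<open>g\<close> is convex if \<open>u\<close> is directionally convex
  (\<open>shift_avg_iter_convex\<close>). The counts of the Poisson process have the same form: by the thinning
  property, independent Poisson counts with means \<open>r * F(B\<^sub>i)\<close> arise from a Poisson number of points,
  so that the expectation of \<open>u\<close> is the expectation of \<open>g\<close> at a Poisson variable
  (\<open>expectation_indep_poisson\<close> and \<open>poisson_mixture_residual_cell\<close>). The convex order of the numbers of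
  points therefore yields the inequality for \<open>u\<close>.

  Integrability is not an obstacle, because a directionally convex function lies on the lattice above
  the affine function that interpolates it at the origin and the unit vectors
  (\<open>directionally_convex_above_tangent\<close>). The affine part has the same finite expectation for both
  processes, and what remains is a non-negative directionally convex function \<open>u\<close>.
\<close>

section \<open>The factorially weighted distribution is log-concave\<close>

text \<open>For sequences that may vanish, this two-index form is stronger than the inequalities between
  neighbours: it also excludes internal zeros. Unlike the absence of internal zeros, it is a
  closed condition, so it survives pointwise limits.\<close>
definition log_concave :: "(nat \<Rightarrow> real) \<Rightarrow> bool" where
  "log_concave b \<longleftrightarrow> (\<forall>i. 0 \<le> b i) \<and> (\<forall>i k. i \<le> k \<longrightarrow> b i * b (Suc k) \<le> b (Suc i) * b k)"

text \<open>The inequality for \<open>(i, k + 1)\<close> is the product of those for \<open>(i, k)\<close>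
  and for the neighbours of \<open>k + 1\<close>, divided by \<open>b k * b (k + 1)\<close>; this
  is where internal zeros would do harm.\<close>
lemma log_concaveI_local:
  assumes nonneg: "\<And>i. 0 \<le> b i"
    and loc: "\<And>i. b i * b (Suc (Suc i)) \<le> (b (Suc i))\<^sup>2"
    and gaps: "\<And>i j k. i < j \<Longrightarrow> j < k \<Longrightarrow> b i \<noteq> 0 \<Longrightarrow> b k \<noteq> 0 \<Longrightarrow> b j \<noteq> 0"
  shows "log_concave b"
proof -
  have "b i * b (Suc k) \<le> b (Suc i) * b k" if "i \<le> k" for i k
    using that
  proof (induction k rule: dec_induct)
    case base
    show ?case by simp
  next
    case (step k)
    show ?case
    proof (cases "b i = 0 \<or> b (Suc (Suc k)) = 0")
      case True
      then show ?thesis using nonneg[of "Suc i"] nonneg[of k] nonneg[of "Suc k"] by auto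
    next
      case False
      have "b k \<noteq> 0"
        using gaps[of i k "Suc (Suc k)"] \<open>i \<le> k\<close> False by (cases "i = k") auto
      moreover have "b (Suc k) \<noteq> 0"
        using gaps[of i "Suc k" "Suc (Suc k)"] \<open>i \<le> k\<close> False by auto
      ultimately have pos: "0 < b k" "0 < b (Suc k)"
        using nonneg[of k] nonneg[of "Suc k"] by linarith+
      have "(b i * b (Suc k)) * (b k * b (Suc (Suc k))) \<le> (b (Suc i) * b k) * (b (Suc k))\<^sup>2"
        by (rule mult_mono[OF step.IH loc]) (simp_all add: nonneg)
      then have "(b i * b (Suc (Suc k))) * (b k * b (Suc k)) \<le> (b (Suc i) * b (Suc k)) * (b k * b (Suc k))"
        by (simp add: power2_eq_square mult_ac)
      then show ?thesis
        by (rule mult_right_le_imp_le) (simp add: pos)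
    qed
  qed
  then show ?thesis using nonneg unfolding log_concave_def by blast
qed

text \<open>Since \<open>i! (n choose i) = n! / (n - i)!\<close>, ultra log-concavity of \<open>p\<close>
  says for \<open>b i = i! p i\<close> that \<open>b i * b (i + 2) \<le> c * (b (i +
  1))\<^sup>2\<close> with \<open>c = (n - i - 1)!\<^sup>2 / ((n - i)! (n - i - 2)!) < 1\<close>.\<close>
lemma ULC_pmfs_log_concave:
  assumes "p \<in> ULC_pmfs n"
  shows "log_concave (\<lambda>i. fact i * pmf p i)"
proof (rule log_concaveI_local)
  have ulc: "ULC n (pmf p)" and supp: "set_pmf p \<subseteq> {..n}"
    using assms by (auto simp: ULC_pmfs_def)
  have zero: "pmf p i = 0" if "n < i" for i
    using supp that by (auto simp: pmf_eq_0_set_pmf)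
  show "0 \<le> fact i * pmf p i" for i by simp
  show "fact i * pmf p i * (fact (Suc (Suc i)) * pmf p (Suc (Suc i))) \<le> (fact (Suc i) * pmf p (Suc i))\<^sup>2" for i
  proof (cases "Suc i < n")
    case False
    then show ?thesis using zero[of "Suc (Suc i)"] by simp
  next
    case True
    define d where "d = n - Suc (Suc i)"
    have n: "n = Suc (Suc (i + d))" using True by (simp add: d_def)
    define b where "b j = fact j * pmf p j" for j
    have quot: "pmf p j / real (n choose j) = b j * fact (n - j) / fact n" if "j \<le> n" for j
      using that by (simp add: binomial_fact b_def)
    have "(pmf p i / real (n choose i)) * (pmf p (Suc (Suc i)) / real (n choose (Suc (Suc i))))
        \<le> (pmf p (Suc i) / real (n choose (Suc i)))\<^sup>2"
      using ulc True unfolding ULC_def by (elim conjE) (drule spec[of _ "Suc i"], simp)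
    moreover have "n - i = Suc (Suc d)" "n - Suc i = Suc d" "n - Suc (Suc i) = d"
      by (auto simp: n)
    ultimately have "(b i * fact (Suc (Suc d)) / fact n) * (b (Suc (Suc i)) * fact d / fact n)
       \<le> (b (Suc i) * fact (Suc d) / fact n)\<^sup>2"
      using quot[of i] quot[of "Suc i"] quot[of "Suc (Suc i)"] True by (simp del: fact_Suc)
    then have "(b i * b (Suc (Suc i))) * (fact (Suc (Suc d)) * fact d) \<le> (b (Suc i))\<^sup>2 * (fact (Suc d) * fact (Suc d))"
      by (simp add: power2_eq_square divide_le_cancel mult_ac del: fact_Suc)
    moreover have "fact (Suc d) * fact (Suc d) \<le> (fact (Suc (Suc d)) * fact d :: real)"
    proof -
      have "fact (Suc d) * fact (Suc d) = real (Suc d) * (fact (Suc d) * fact d)"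
        by (simp add: algebra_simps)
      also have "\<dots> \<le> real (Suc (Suc d)) * (fact (Suc d) * fact d)"
        by (intro mult_right_mono) (auto simp del: fact_Suc)
      finally show ?thesis by (simp only: fact_Suc[of "Suc d"] mult.assoc of_nat_mult of_nat_fact)
    qed
    moreover have "0 \<le> b i * b (Suc (Suc i))" by (simp add: b_def)
    ultimately have "(b i * b (Suc (Suc i))) * (fact (Suc d) * fact (Suc d)) \<le> (b (Suc i))\<^sup>2 * (fact (Suc d) * fact (Suc d))"
      using order_trans[OF mult_left_mono] by blast
    then have "b i * b (Suc (Suc i)) \<le> (b (Suc i))\<^sup>2"
      by (rule mult_right_le_imp_le) (simp del: fact_Suc)
    then show ?thesis by (simp add: b_def del: fact_Suc)
  qed
  fix i j k :: nat assume "i < j" "j < k" "fact i * pmf p i \<noteq> 0" "fact k * pmf p k \<noteq> 0"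
  moreover from this have "k \<le> n" using zero[of k] by force
  ultimately have "pmf p j \<noteq> 0"
    using ulc unfolding ULC_def no_internal_zeros_def by (metis mult_zero_right)
  then show "fact j * pmf p j \<noteq> 0" by simp
qed

lemma log_concave_limit:
  assumes "\<And>k. log_concave (b k)" and "\<And>i. (\<lambda>k. b k i) \<longlonglongrightarrow> c i"
  shows "log_concave c"
  unfolding log_concave_def
proof (intro conjI allI impI)
  show "0 \<le> c i" for i
    using assms(1) by (intro LIMSEQ_le_const[OF assms(2)]) (auto simp: log_concave_def)
  fix i k :: nat assume "i \<le> k"
  then show "c i * c (Suc k) \<le> c (Suc i) * c k"
    using assms(1) by (intro LIMSEQ_le[OF tendsto_mult[OF assms(2) assms(2)] tendsto_mult[OF assms(2) assms(2)]])
      (auto simp: log_concave_def)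
qed

lemma pmf_eq_cdf_diff:
  "pmf p i = cdf (distr (measure_pmf p) borel real) (real i + 1/2) -
     cdf (distr (measure_pmf p) borel real) (real i - 1/2)"
proof -
  have "real -` {..real i + 1/2} = {..i}" "real -` {..real i - 1/2} = {..<i}"
    by auto
  then have "cdf (distr (measure_pmf p) borel real) (real i + 1/2) = measure_pmf.prob p {..i}"
    "cdf (distr (measure_pmf p) borel real) (real i - 1/2) = measure_pmf.prob p {..<i}"
    unfolding cdf_def by (simp_all add: measure_distr)
  moreover have "measure_pmf.prob p {..i} = measure_pmf.prob p {..<i} + measure_pmf.prob p {i}"
    unfolding ivl_disj_un(2)[symmetric] by (rule measure_pmf.finite_measure_Union) auto
  ultimately show ?thesis by (simp add: measure_pmf_single)
qed

text \<open>The half-integers are continuity points of every limit that is carried by the integers, and a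
  point mass is the increment of the distribution function between two of them.\<close>
lemma weak_conv_pmf_pointwise:
  assumes "weak_conv_m (\<lambda>k. distr (measure_pmf (q k)) borel real) (distr (measure_pmf p) borel real)"
  shows "(\<lambda>k. pmf (q k) i) \<longlonglongrightarrow> pmf p i"
proof -
  interpret D: prob_space "distr (measure_pmf p) borel real"
    by (rule measure_pmf.prob_space_distr) simp
  interpret D: finite_borel_measure "distr (measure_pmf p) borel real"
    by unfold_locales simp
  have conv: "(\<lambda>k. cdf (distr (measure_pmf (q k)) borel real) x) \<longlonglongrightarrow> cdf (distr (measure_pmf p) borel real) x"
    if "x \<notin> range real" for x
  proof -
    have "isCont (cdf (distr (measure_pmf p) borel real)) x"
    proof (subst D.isCont_cdf, subst measure_distr)
      have "real -` {x} = {}" using that by auto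
      then show "measure_pmf.prob p (real -` {x} \<inter> space (measure_pmf p)) = 0" by simp
    qed auto
    then show ?thesis using assms by (simp add: weak_conv_m_def weak_conv_def)
  qed
  have "real i + 1/2 \<notin> range real"
  proof safe
    fix j assume "real i + 1/2 = real j"
    then have "real (2 * i + 1) = real (2 * j)" by simp
    then show False unfolding of_nat_eq_iff by presburger
  qed
  moreover have "real i - 1/2 \<notin> range real"
  proof safe
    fix j assume "real i - 1/2 = real j"
    then have "real (2 * i) = real (2 * j + 1)" by simp
    then show False unfolding of_nat_eq_iff by presburger
  qed
  ultimately show ?thesis
    unfolding pmf_eq_cdf_diff by (intro tendsto_diff conv)
qed

lemma class_S_log_concave:
  assumes "p \<in> class_S"
  shows "log_concave (\<lambda>i. fact i * pmf p i)"
proof -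
  obtain q where q: "\<And>k. q k \<in> (\<Union>n\<in>{1..}. ULC_pmfs n)"
    and conv: "weak_conv_m (\<lambda>k. distr (measure_pmf (q k)) borel real) (distr (measure_pmf p) borel real)"
    using assms unfolding class_S_def mem_Collect_eq by blast
  show ?thesis
  proof (rule log_concave_limit[where b = "\<lambda>k i. fact i * pmf (q k) i"])
    show "log_concave (\<lambda>i. fact i * pmf (q k) i)" for k
      using q[of k] ULC_pmfs_log_concave by blast
    show "(\<lambda>k. fact i * pmf (q k) i) \<longlonglongrightarrow> fact i * pmf p i" for i
      by (intro tendsto_mult_left weak_conv_pmf_pointwise conv)
  qed
qed

section \<open>Convex comparison with the Poisson distribution\<close>

definition poisson_weight :: "real \<Rightarrow> nat \<Rightarrow> real" where
  "poisson_weight r k = r ^ k / fact k * exp (- r)"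

lemma poisson_weight_nonneg: "0 \<le> r \<Longrightarrow> 0 \<le> poisson_weight r k"
  by (simp add: poisson_weight_def)

lemma exp_series_sums: "(\<lambda>k. r ^ k / fact k) sums exp (r :: real)"
  using exp_converges[of r] by (simp add: divide_inverse mult.commute)

lemma poisson_weight_sums: "poisson_weight r sums 1"
proof -
  have "(\<lambda>k. r ^ k / fact k * exp (- r)) sums (exp r * exp (- r))"
    by (rule sums_mult2[OF exp_series_sums])
  then show ?thesis by (simp add: poisson_weight_def[abs_def] exp_minus_inverse)
qed

lemma poisson_weight_mean: "(\<lambda>k. real k * poisson_weight r k) sums r"
proof -
  have "(\<lambda>k. r * poisson_weight r k) sums (r * 1)"
    by (rule sums_mult[OF poisson_weight_sums])
  moreover have "r * poisson_weight r k = real (Suc k) * poisson_weight r (Suc k)" for k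
    by (simp add: poisson_weight_def divide_simps del: of_nat_Suc)
  ultimately have "(\<lambda>k. real (Suc k) * poisson_weight r (Suc k)) sums r" by simp
  then show ?thesis by (subst (asm) sums_Suc_iff) simp
qed

text \<open>A log-concave sequence that once drops, from a value above \<open>c\<close> to one not above
  \<open>c\<close>, keeps decreasing, because its ratios decrease; so it cannot return above
  \<open>c\<close>.\<close>
lemma log_concave_superlevel:
  assumes "log_concave h" "i < j" "j < k" "c < h i" "c < h k"
  shows "c < h j"
proof (rule ccontr)
  assume "\<not> c < h j"
  define m where "m = (LEAST m. i < m \<and> h m \<le> c)"
  have m: "i < m" "h m \<le> c" "m \<le> j"
    using LeastI[of "\<lambda>m. i < m \<and> h m \<le> c" j] Least_le[of "\<lambda>m. i < m \<and> h m \<le> c" j]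
      \<open>\<not> c < h j\<close> \<open>i < j\<close> by (auto simp: m_def)
  then obtain m' where m': "m = Suc m'" by (cases m) auto
  have "c < h m'"
  proof (cases "i = m'")
    case False
    then have "i < m'" using m m' by simp
    then show ?thesis using not_less_Least[of m' "\<lambda>m. i < m \<and> h m \<le> c"] m' by (auto simp: m_def)
  qed (use assms in simp)
  then have drop: "h m < h m'" using m by linarith
  have "h l \<le> c" if "m \<le> l" for l
    using that
  proof (induction l rule: dec_induct)
    case base
    show ?case by (rule m)
  next
    case (step l)
    have "0 < h m'" "0 \<le> h l" using assms(1) drop unfolding log_concave_def by (metis le_less_trans)+
    have "h m' * h (Suc l) \<le> h m * h l"
      using assms(1) step(1) m' by (simp add: log_concave_def)
    also have "\<dots> \<le> h m' * h l" using drop \<open>0 \<le> h l\<close> by (simp add: mult_right_mono)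
    finally have "h (Suc l) \<le> h l" using \<open>0 < h m'\<close> by simp
    then show ?case using step.IH by linarith
  qed
  then have "h k \<le> c" using m \<open>j < k\<close> by simp
  then show False using \<open>c < h k\<close> by simp
qed

lemma convex_sequence_chord:
  fixes g :: "nat \<Rightarrow> real"
  assumes conv: "\<And>k. 2 * g (Suc k) \<le> g k + g (Suc (Suc k))" and "i \<le> j" "j \<le> k"
  shows "real (k - i) * g j \<le> real (k - j) * g i + real (j - i) * g k"
proof -
  define d where "d k = g (Suc k) - g k" for k
  have mono: "d m \<le> d l" if "m \<le> l" for m l
    using that by (rule lift_Suc_mono_le[rotated]) (use conv in \<open>auto simp: d_def algebra_simps\<close>)
  have left: "g j - g i \<le> real (j - i) * d j"
    using \<open>i \<le> j\<close>
  proof (induction i rule: inc_induct)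
    case (step i)
    then have "real (j - i) = real (j - Suc i) + 1" by linarith
    then show ?case using step.IH mono[of i j] step.hyps by (simp add: d_def algebra_simps)
  qed simp
  have right: "real (k - j) * d j \<le> g k - g j"
    using \<open>j \<le> k\<close>
  proof (induction k rule: dec_induct)
    case (step k)
    then have "real (Suc k - j) = real (k - j) + 1" by linarith
    then show ?case using step.IH mono[of j k] step.hyps by (simp add: d_def algebra_simps)
  qed simp
  have "real (k - j) * (g j - g i) \<le> real (k - j) * (real (j - i) * d j)"
    using left by (rule mult_left_mono) simp
  also have "\<dots> = real (j - i) * (real (k - j) * d j)" by simp
  also have "\<dots> \<le> real (j - i) * (g k - g j)"
    using right by (rule mult_left_mono) simp
  moreover have "real (k - i) = real (k - j) + real (j - i)" using assms(2,3) by linarith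
  ultimately show ?thesis by (simp add: algebra_simps)
qed

text \<open>If an affine function separates \<open>g\<close> in the sense that \<open>g\<close> lies above
  it where \<open>q\<close> has more mass than \<open>p\<close> and below it where
  \<open>p\<close> has more, then replacing \<open>p\<close> by \<open>q\<close> increases the
  integral of the difference; the affine part itself has the same integral under both because
  mass and mean agree. The factor \<open>A\<close> avoids normalising the slope.\<close>
lemma suminf_le_of_affine_cut:
  fixes p q g :: "nat \<Rightarrow> real"
  assumes p: "\<And>k. 0 \<le> p k" "p sums 1" "(\<lambda>k. real k * p k) sums r"
    and q: "\<And>k. 0 \<le> q k" "q sums 1" "(\<lambda>k. real k * q k) sums r"
    and g: "\<And>k. 0 \<le> g k" and "0 < A"
    and cut: "\<And>k. 0 \<le> (q k - p k) * (A * g k + B + C * real k)"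
  shows "(\<Sum>k. ennreal (p k * g k)) \<le> (\<Sum>k. ennreal (q k * g k))"
proof (cases "(\<Sum>k. ennreal (q k * g k)) = top")
  case False
  then have sq: "summable (\<lambda>k. q k * g k)" by (intro summable_suminf_not_top) (simp_all add: q g)
  define R where "R k = q k * g k + (B / A) * (q k - p k) + (C / A) * (real k * q k - real k * p k)" for k
  have le: "p k * g k \<le> R k" for k
  proof -
    have "A * (p k * g k) \<le> A * R k"
      using cut[of k] \<open>0 < A\<close> by (simp add: R_def algebra_simps)
    then show ?thesis using \<open>0 < A\<close> by simp
  qed
  have "R sums ((\<Sum>k. q k * g k) + (B / A) * (1 - 1) + (C / A) * (r - r))"
    unfolding R_def by (intro sums_add sums_mult sums_diff p q summable_sums sq)
  then have R: "R sums (\<Sum>k. q k * g k)" by simp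
  have sp: "summable (\<lambda>k. p k * g k)"
  proof (rule summable_comparison_test'[of R 0])
    show "summable R" using R by (simp add: sums_iff)
    show "norm (p k * g k) \<le> R k" for k using le[of k] p(1)[of k] g[of k] by simp
  qed
  have "(\<Sum>k. p k * g k) \<le> (\<Sum>k. q k * g k)"
    using suminf_le[OF le sp] R by (simp add: sums_iff)
  then show ?thesis by (simp add: suminf_ennreal2 sp sq p q g ennreal_leI)
qed simp

text \<open>The Karlin--Novikoff cut argument. The likelihood ratio with respect to the Poisson weights is,
  up to a constant, \<open>k! p k / r ^ k\<close>, which is log-concave; hence the set
  \<open>S\<close> where \<open>p\<close> exceeds the Poisson weights is an interval. It is
  bounded, as otherwise \<open>p\<close> would be strictly stochastically larger and could not
  have the same mean. The chord of \<open>g\<close> over the end points of \<open>S\<close> lies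
  above \<open>g\<close> on \<open>S\<close> and below \<open>g\<close> off \<open>S\<close>, so
  it separates as required.\<close>
lemma log_concave_convex_le_poisson:
  fixes p g :: "nat \<Rightarrow> real"
  assumes p: "\<And>k. 0 \<le> p k" "p sums 1" "(\<lambda>k. real k * p k) sums r"
    and lc: "log_concave (\<lambda>k. fact k * p k)"
    and g: "\<And>k. 0 \<le> g k" and conv: "\<And>k. 2 * g (Suc k) \<le> g k + g (Suc (Suc k))"
  shows "(\<Sum>k. ennreal (p k * g k)) \<le> (\<Sum>k. ennreal (poisson_weight r k * g k))"
proof -
  let ?q = "poisson_weight r"
  define S where "S = {k. ?q k < p k}"
  have "0 \<le> r" using sums_le[OF _ sums_zero p(3)] p(1) by simp
  have cut: ?thesis if "0 < A" "\<And>k. 0 \<le> (?q k - p k) * (A * g k + B + C * real k)" for A B C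
    using suminf_le_of_affine_cut[OF p poisson_weight_nonneg[OF \<open>0 \<le> r\<close>] poisson_weight_sums poisson_weight_mean g that] .
  have interval: "j \<in> S" if "i < j" "j < k" "i \<in> S" "k \<in> S" for i j k
  proof -
    (* With mean zero, all mass is at 0, so S has no positive element. *)
    have "r \<noteq> 0"
    proof
      assume "r = 0"
      then have "real k * p k \<le> 0"
        using sum_le_suminf[of "\<lambda>k. real k * p k" "{k}"] p by (simp add: sums_iff)
      then have "p k \<le> 0" using that by (simp add: mult_le_0_iff)
      then show False using \<open>k \<in> S\<close> poisson_weight_nonneg[OF \<open>0 \<le> r\<close>, of k] by (simp add: S_def)
    qed
    then have "0 < r" using \<open>0 \<le> r\<close> by simp
    then have S: "l \<in> S \<longleftrightarrow> exp (- r) < fact l * p l / r ^ l" for l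
      by (simp add: S_def poisson_weight_def field_simps)
    have "log_concave (\<lambda>l. fact l * p l / r ^ l)"
      unfolding log_concave_def
    proof (intro conjI allI impI)
      show "0 \<le> fact l * p l / r ^ l" for l using \<open>0 < r\<close> p by simp
      fix l m :: nat assume "l \<le> m"
      then have "fact l * p l * (fact (Suc m) * p (Suc m)) / r ^ (l + Suc m) \<le>
         fact (Suc l) * p (Suc l) * (fact m * p m) / r ^ (l + Suc m)"
        using lc \<open>0 < r\<close> unfolding log_concave_def by (intro divide_right_mono) auto
      then show "fact l * p l / r ^ l * (fact (Suc m) * p (Suc m) / r ^ Suc m) \<le>
         fact (Suc l) * p (Suc l) / r ^ Suc l * (fact m * p m / r ^ m)"
        by (simp add: power_add mult_ac del: fact_Suc)
    qed
    from log_concave_superlevel[OF this] that show ?thesis unfolding S by blast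
  qed
  show ?thesis
  proof (cases "S = {}")
    case True
    then have "p k \<le> ?q k" for k by (auto simp: S_def not_less)
    then show ?thesis using g by (intro cut[of 1 0 0]) simp_all
  next
    case False
    define a where "a = (LEAST k. k \<in> S)"
    have a: "a \<in> S" "\<And>k. k \<in> S \<Longrightarrow> a \<le> k"
      using False by (auto simp: a_def intro: LeastI Least_le)
    have "finite S"
    proof (rule ccontr)
      assume "infinite S"
      then have S: "k \<in> S \<longleftrightarrow> a \<le> k" for k
        using a interval[of a k] unfolding infinite_nat_iff_unbounded by (metis le_neq_implies_less)
      (* The factor is 2 (k - (a - 1/2)): it changes sign strictly between a - 1 and a. *)
      define D where "D k = (p k - ?q k) * (2 * real k - 2 * real a + 1)" for k
      have D: "0 \<le> D k" for k
      proof (cases "a \<le> k")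
        case True
        then have "?q k \<le> p k" using S[of k] by (simp add: S_def)
        then show ?thesis using True by (simp add: D_def)
      next
        case False
        then have "p k \<le> ?q k" "2 * real k - 2 * real a + 1 \<le> 0" using S[of k] by (auto simp: S_def)
        then show ?thesis by (simp add: D_def mult_nonpos_nonpos)
      qed
      have "(\<lambda>k. 2 * (real k * p k - real k * ?q k) + (1 - 2 * real a) * (p k - ?q k)) sums
          (2 * (r - r) + (1 - 2 * real a) * (1 - 1))"
        by (intro sums_add sums_mult sums_diff p poisson_weight_sums poisson_weight_mean)
      then have "D sums 0" by (simp add: D_def[abs_def] algebra_simps)
      then have "D a \<le> 0" using sum_le_suminf[of D "{a}"] D by (simp add: sums_iff)
      then show False using a(1) by (simp add: D_def S_def)
    qed
    define b where "b = Max S"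
    have b: "b \<in> S" "\<And>k. k \<in> S \<Longrightarrow> k \<le> b"
      using False \<open>finite S\<close> by (auto simp: b_def)
    have S: "k \<in> S \<longleftrightarrow> a \<le> k \<and> k \<le> b" for k
      using a b interval[of a k b] by (metis le_neq_implies_less)
    have "a \<le> b" using a b by blast
    note chord = convex_sequence_chord[of g, OF conv]
    show ?thesis
    proof (cases "a = b")
      case True
      (* The chord degenerates; the line through g a and g (a + 1) supports g at a. *)
      show ?thesis
      proof (rule cut[of 1 "real a * (g (Suc a) - g a) - g a" "- (g (Suc a) - g a)"])
        fix k
        show "0 \<le> (?q k - p k) * (1 * g k + (real a * (g (Suc a) - g a) - g a) + - (g (Suc a) - g a) * real k)"
        proof (cases "k = a")
          case False
          then have "p k \<le> ?q k" using S[of k] True by (auto simp: S_def)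
          moreover have "0 \<le> 1 * g k + (real a * (g (Suc a) - g a) - g a) + - (g (Suc a) - g a) * real k"
          proof (cases "a < k")
            case True
            then show ?thesis using chord[of a "Suc a" k] by (simp add: of_nat_diff algebra_simps)
          next
            case False
            then show ?thesis using chord[of k a "Suc a"] by (simp add: of_nat_diff algebra_simps)
          qed
          ultimately show ?thesis by simp
        qed (simp add: algebra_simps)
      qed simp
    next
      case False
      then have "a < b" using \<open>a \<le> b\<close> by simp
      show ?thesis
      proof (rule cut[of "real b - real a" "real a * g b - real b * g a" "g a - g b"])
        fix k
        let ?D = "(real b - real a) * g k + (real a * g b - real b * g a) + (g a - g b) * real k"
        show "0 \<le> (?q k - p k) * ?D"
        proof (cases "k \<in> S")
          case True
          then have "?D \<le> 0" using chord[of a k b] S[of k] by (simp add: of_nat_diff algebra_simps)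
          then show ?thesis using True by (intro mult_nonpos_nonpos) (simp_all add: S_def)
        next
          case False
          then have "0 \<le> ?D"
            using chord[of k a b] chord[of a b k] S[of k] \<open>a < b\<close>
            by (cases "k < a") (simp_all add: of_nat_diff algebra_simps)
          then show ?thesis using False by (simp add: S_def)
        qed
      qed (use \<open>a < b\<close> in simp)
    qed
  qed
qed

section \<open>Averaging over the position of one additional point\<close>

text \<open>The value at \<open>x\<close> is the expectation of \<open>u\<close> after one more point has
  been put into cell \<open>i\<close> with probability \<open>w i\<close>, starting from cell
  counts \<open>x\<close>. Its powers describe multinomial counts without multinomial
  coefficients. For weights of total mass below \<open>1\<close> the expectation is restricted to
  points in the first \<open>m\<close> cells; in this form the cells can be added one by one.\<close>
definition shift_avg :: "(nat \<Rightarrow> real) \<Rightarrow> nat \<Rightarrow> ((nat \<Rightarrow> nat) \<Rightarrow> real) \<Rightarrow> (nat \<Rightarrow> nat) \<Rightarrow> real" where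
  "shift_avg w m u x = (\<Sum>i<m. w i * u (x(i := Suc (x i))))"

lemma shift_avg_Suc:
  "shift_avg w (Suc m) u x = shift_avg w m u x + w m * u (x(m := Suc (x m)))"
  by (simp add: shift_avg_def)

lemma shift_avg_mono:
  assumes "\<And>i. 0 \<le> w i" "\<And>x. u x \<le> v x"
  shows "shift_avg w m u x \<le> shift_avg w m v x"
  unfolding shift_avg_def by (intro sum_mono mult_left_mono assms)

lemma shift_avg_iter_nonneg:
  assumes "\<And>i. 0 \<le> w i" "\<And>x. 0 \<le> u x"
  shows "0 \<le> (shift_avg w m ^^ k) u x"
  by (induction k arbitrary: x) (auto simp: shift_avg_def assms intro!: sum_nonneg)

lemma shift_avg_iter_fun_upd:
  assumes "\<And>x j. u (x(m := j)) = u x"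
  shows "(shift_avg w m ^^ k) u (x(m := j)) = (shift_avg w m ^^ k) u x"
proof (induction k arbitrary: x)
  case (Suc k)
  have "(shift_avg w m ^^ k) u ((x(m := j))(i := Suc (x i))) = (shift_avg w m ^^ k) u (x(i := Suc (x i)))" if "i < m" for i
    unfolding fun_upd_twist[OF less_imp_neq[OF that, symmetric]] by (rule Suc)
  then show ?case
    unfolding funpow.simps o_def shift_avg_def[of w m "(shift_avg w m ^^ k) u"]
    by (intro sum.cong refl) simp
qed (simp add: assms)

lemma shift_avg_iter_coordinate:
  assumes "(\<Sum>i<m. w i) = 1" "l < m"
  shows "(shift_avg w m ^^ k) (\<lambda>x. real (x l)) x = real (x l) + real k * w l"
proof (induction k arbitrary: x)
  case (Suc k)
  have "(shift_avg w m ^^ Suc k) (\<lambda>x. real (x l)) x = shift_avg w m (\<lambda>x. real (x l) + real k * w l) x"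
    by (simp add: Suc[abs_def])
  also have "\<dots> = (\<Sum>i<m. w i * (real (x l) + real k * w l) + (if i = l then w i else 0))"
    unfolding shift_avg_def by (intro sum.cong refl) (simp add: algebra_simps)
  also have "\<dots> = (\<Sum>i<m. w i) * (real (x l) + real k * w l) + w l"
    using \<open>l < m\<close> by (simp add: sum.distrib sum_distrib_right)
  finally show ?case by (simp add: assms algebra_simps)
qed simp

text \<open>Directional convexity for unit increments of integer vectors.\<close>
definition lattice_dcx :: "nat \<Rightarrow> ((nat \<Rightarrow> nat) \<Rightarrow> real) \<Rightarrow> bool" where
  "lattice_dcx m u \<longleftrightarrow> (\<forall>i<m. \<forall>j<m. \<forall>x.
     u (x(i := Suc (x i))) + u (x(j := Suc (x j))) \<le>
     u x + u ((x(i := Suc (x i)))(j := Suc ((x(i := Suc (x i))) j))))"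

text \<open>Write \<open>T\<close> for the averaging operator. As the weights add up to \<open>1\<close>,
  \<open>(T - 1)\<^sup>2 u\<close> is the average \<open>\<Sum>i j. w i * w j * \<Delta>\<^sub>i
  \<Delta>\<^sub>j u\<close> of second differences, hence non-negative; powers of
  \<open>T\<close> preserve this. So the expectation of \<open>u\<close> is convex in the number
  of points.\<close>
lemma shift_avg_iter_convex:
  assumes w: "\<And>i. 0 \<le> w i" "(\<Sum>i<m. w i) = 1" and u: "lattice_dcx m u"
  shows "2 * (shift_avg w m ^^ Suc k) u x \<le> (shift_avg w m ^^ k) u x + (shift_avg w m ^^ Suc (Suc k)) u x"
proof (induction k arbitrary: x)
  case 0
  let ?e = "\<lambda>x i. x(i := Suc (x i)) :: nat \<Rightarrow> nat"
  have "2 * shift_avg w m u x = (\<Sum>i<m. \<Sum>j<m. w i * w j * (u (?e x i) + u (?e x j)))"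
  proof -
    have "(\<Sum>i<m. \<Sum>j<m. w i * w j * (u (?e x i) + u (?e x j))) =
      (\<Sum>i<m. (\<Sum>j<m. w j) * (w i * u (?e x i)) + w i * shift_avg w m u x)"
      by (simp add: shift_avg_def sum_distrib_left sum_distrib_right sum.distrib algebra_simps)
    also have "\<dots> = shift_avg w m u x + (\<Sum>i<m. w i) * shift_avg w m u x"
      by (simp only: w(2) sum.distrib sum_distrib_right[symmetric] mult_1_left) (simp add: shift_avg_def)
    finally show ?thesis by (simp add: w)
  qed
  also have "\<dots> \<le> (\<Sum>i<m. \<Sum>j<m. w i * w j * (u x + u (?e (?e x i) j)))"
    using u unfolding lattice_dcx_def by (intro sum_mono mult_left_mono mult_nonneg_nonneg w) auto
  also have "\<dots> = (\<Sum>i<m. w i) * (\<Sum>j<m. w j) * u x + shift_avg w m (shift_avg w m u) x"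
    by (simp add: shift_avg_def sum_distrib_left sum_distrib_right sum.distrib algebra_simps)
  finally show ?case by (simp add: w)
next
  case (Suc k)
  have "2 * shift_avg w m ((shift_avg w m ^^ Suc k) u) x = shift_avg w m (\<lambda>x. 2 * (shift_avg w m ^^ Suc k) u x) x"
    by (simp add: shift_avg_def sum_distrib_left algebra_simps)
  also have "\<dots> \<le> shift_avg w m (\<lambda>x. (shift_avg w m ^^ k) u x + (shift_avg w m ^^ Suc (Suc k)) u x) x"
    by (rule shift_avg_mono[OF w(1) Suc])
  also have "\<dots> = shift_avg w m ((shift_avg w m ^^ k) u) x + shift_avg w m ((shift_avg w m ^^ Suc (Suc k)) u) x"
    by (simp add: shift_avg_def[of w m "\<lambda>x. _ x + _ x"] sum.distrib algebra_simps)
       (simp add: shift_avg_def)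
  finally show ?case by simp
qed

text \<open>The shift in cell \<open>m\<close> commutes with the shifts in the lower cells, so this is the
  binomial theorem for the sum of two commuting operators.\<close>
lemma shift_avg_iter_binomial:
  "(shift_avg w (Suc m) ^^ k) u x =
     (\<Sum>j\<le>k. real (k choose j) * w m ^ j * (shift_avg w m ^^ (k - j)) u (x(m := x m + j)))"
proof (induction k arbitrary: x)
  case (Suc k)
  define B where "B l j = (shift_avg w m ^^ l) u (x(m := x m + j))" for l j
  have low: "shift_avg w m ((shift_avg w (Suc m) ^^ k) u) x = (\<Sum>j\<le>k. real (k choose j) * w m ^ j * B (Suc k - j) j)"
  proof -
    have "shift_avg w m ((shift_avg w (Suc m) ^^ k) u) x =
      (\<Sum>i<m. \<Sum>j\<le>k. w i * (real (k choose j) * w m ^ j *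
         (shift_avg w m ^^ (k - j)) u ((x(m := x m + j))(i := Suc (x i)))))"
      unfolding shift_avg_def[of w m "(shift_avg w (Suc m) ^^ k) u"] Suc sum_distrib_left
      by (intro sum.cong refl) (simp add: fun_upd_twist)
    also have "\<dots> = (\<Sum>j\<le>k. \<Sum>i<m. w i * (real (k choose j) * w m ^ j *
         (shift_avg w m ^^ (k - j)) u ((x(m := x m + j))(i := Suc (x i)))))"
      by (rule sum.swap)
    also have "\<dots> = (\<Sum>j\<le>k. real (k choose j) * w m ^ j * shift_avg w m ((shift_avg w m ^^ (k - j)) u) (x(m := x m + j)))"
      unfolding shift_avg_def[of w m "(shift_avg w m ^^ _) u"] sum_distrib_left
      by (intro sum.cong refl) (simp add: mult_ac)
    also have "\<dots> = (\<Sum>j\<le>k. real (k choose j) * w m ^ j * B (Suc k - j) j)"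
      by (intro sum.cong refl) (simp add: B_def Suc_diff_le)
    finally show ?thesis .
  qed
  have top: "w m * (shift_avg w (Suc m) ^^ k) u (x(m := Suc (x m))) =
      (\<Sum>j\<le>k. real (k choose j) * w m ^ Suc j * B (k - j) (Suc j))"
    unfolding Suc sum_distrib_left by (intro sum.cong refl) (simp add: B_def)
  have "(\<Sum>j\<le>Suc k. real (Suc k choose j) * w m ^ j * B (Suc k - j) j) =
     B (Suc k) 0 + (\<Sum>j\<le>k. real (Suc k choose Suc j) * w m ^ Suc j * B (k - j) (Suc j))"
    by (subst sum.atMost_Suc_shift) simp
  also have "\<dots> = (B (Suc k) 0 + (\<Sum>j\<le>k. real (k choose Suc j) * w m ^ Suc j * B (k - j) (Suc j)))
      + (\<Sum>j\<le>k. real (k choose j) * w m ^ Suc j * B (k - j) (Suc j))"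
    by (simp add: sum.distrib[symmetric] algebra_simps)
  also have "B (Suc k) 0 + (\<Sum>j\<le>k. real (k choose Suc j) * w m ^ Suc j * B (k - j) (Suc j)) =
      (\<Sum>j\<le>Suc k. real (k choose j) * w m ^ j * B (Suc k - j) j)"
    by (subst sum.atMost_Suc_shift) simp
  also have "\<dots> = (\<Sum>j\<le>k. real (k choose j) * w m ^ j * B (Suc k - j) j)"
    by simp
  also have "\<dots> + (\<Sum>j\<le>k. real (k choose j) * w m ^ Suc j * B (k - j) (Suc j)) = (shift_avg w (Suc m) ^^ Suc k) u x"
    by (simp only: low[symmetric] top[symmetric] funpow.simps o_def shift_avg_Suc)
  finally show ?case by (simp only: B_def)
qed simp

lemma suminf_ennreal_swap: "(\<Sum>i. \<Sum>j. f i j) = (\<Sum>j. \<Sum>i. f i j)" for f :: "nat \<Rightarrow> nat \<Rightarrow> ennreal"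
proof -
  have "(\<Sum>i. \<Sum>j. f i j) = (\<integral>\<^sup>+i. (\<Sum>j. f i j) \<partial>count_space UNIV)"
    by (simp add: nn_integral_count_space_nat)
  also have "\<dots> = (\<Sum>j. \<integral>\<^sup>+i. f i j \<partial>count_space UNIV)"
    by (rule nn_integral_suminf) simp
  finally show ?thesis by (simp add: nn_integral_count_space_nat)
qed

lemma suminf_ennreal_diagonal:
  "(\<Sum>k. \<Sum>j\<le>k. f j (k - j)) = (\<Sum>j. \<Sum>l. f j l)" for f :: "nat \<Rightarrow> nat \<Rightarrow> ennreal"
proof -
  have shift: "(\<Sum>k. if j \<le> k then h (k - j) else 0) = (\<Sum>k. h k)" for h :: "nat \<Rightarrow> ennreal" and j
  proof (induction j)
    case (Suc j)
    let ?F = "\<lambda>k. if Suc j \<le> k then h (k - Suc j) else 0"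
    have "(\<lambda>k. ?F (Suc k)) sums (\<Sum>k. h k)"
      using Suc summable_sums[OF summableI, of "\<lambda>k. if j \<le> k then h (k - j) else 0"]
      by (simp only: Suc_le_mono diff_Suc_Suc)
    then have "?F sums ((\<Sum>k. h k) + ?F 0)" by (rule sums_Suc)
    then show ?case by (simp add: sums_iff)
  qed simp
  have "(\<Sum>k. \<Sum>j\<le>k. f j (k - j)) = (\<Sum>k. \<Sum>j. if j \<le> k then f j (k - j) else 0)"
    by (intro suminf_cong, subst suminf_finite[of "{..k}" for k]) auto
  also have "\<dots> = (\<Sum>j. \<Sum>k. if j \<le> k then f j (k - j) else 0)"
    by (rule suminf_ennreal_swap)
  finally show ?thesis by (simp add: shift)
qed

text \<open>The exponential of a sum of two commuting operators is the product of the exponentials. This is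
  the operator form of the thinning property of the Poisson distribution.\<close>
lemma shift_avg_exp_series:
  assumes "\<And>i. 0 \<le> w i" "\<And>x. 0 \<le> u x" "0 \<le> r"
  shows "(\<Sum>k. ennreal (r ^ k / fact k * (shift_avg w (Suc m) ^^ k) u x)) =
    (\<Sum>j. ennreal ((r * w m) ^ j / fact j) *
       (\<Sum>l. ennreal (r ^ l / fact l * (shift_avg w m ^^ l) u (x(m := x m + j)))))"
proof -
  let ?f = "\<lambda>j l. (r * w m) ^ j / fact j * (r ^ l / fact l * (shift_avg w m ^^ l) u (x(m := x m + j)))"
  have nonneg: "0 \<le> ?f j l" for j l
    using assms by (intro mult_nonneg_nonneg divide_nonneg_nonneg zero_le_power shift_avg_iter_nonneg) simp_all
  have "r ^ k / fact k * (shift_avg w (Suc m) ^^ k) u x = (\<Sum>j\<le>k. ?f j (k - j))" for k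
    unfolding shift_avg_iter_binomial sum_distrib_left
  proof (intro sum.cong refl)
    fix j assume "j \<in> {..k}"
    then have "r ^ k = r ^ j * r ^ (k - j)" by (simp add: power_add[symmetric])
    with \<open>j \<in> {..k}\<close> show "r ^ k / fact k * (real (k choose j) * w m ^ j * (shift_avg w m ^^ (k - j)) u (x(m := x m + j)))
        = ?f j (k - j)"
      by (simp add: binomial_fact power_mult_distrib)
  qed
  then have "(\<Sum>k. ennreal (r ^ k / fact k * (shift_avg w (Suc m) ^^ k) u x)) = (\<Sum>k. \<Sum>j\<le>k. ennreal (?f j (k - j)))"
    using nonneg by (simp add: sum_ennreal)
  also have "\<dots> = (\<Sum>j. \<Sum>l. ennreal (?f j l))" by (rule suminf_ennreal_diagonal)
  also have "\<dots> = (\<Sum>j. ennreal ((r * w m) ^ j / fact j) *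
       (\<Sum>l. ennreal (r ^ l / fact l * (shift_avg w m ^^ l) u (x(m := x m + j)))))"
  proof (rule suminf_cong)
    fix j
    have "ennreal (?f j l) = ennreal ((r * w m) ^ j / fact j) *
        ennreal (r ^ l / fact l * (shift_avg w m ^^ l) u (x(m := x m + j)))" for l
      using assms by (intro ennreal_mult) (simp_all add: shift_avg_iter_nonneg)
    then show "(\<Sum>l. ennreal (?f j l)) = ennreal ((r * w m) ^ j / fact j) *
       (\<Sum>l. ennreal (r ^ l / fact l * (shift_avg w m ^^ l) u (x(m := x m + j))))"
      by (simp only: ennreal_suminf_cmult)
  qed
  finally show ?thesis .
qed

section \<open>The laws of the two count vectors\<close>

text \<open>Restriction to an independent event multiplies the law of \<open>W\<close> by the probability
  of the event.\<close>
lemma (in prob_space) nn_integral_indicator_indep: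
  assumes E: "E \<in> events" and W: "W \<in> measurable M M'"
    and indep: "\<And>A. A \<in> sets M' \<Longrightarrow> prob (E \<inter> (W -` A \<inter> space M)) = prob E * prob (W -` A \<inter> space M)"
    and \<phi>: "\<phi> \<in> borel_measurable M'"
  shows "(\<integral>\<^sup>+\<omega>. indicator E \<omega> * \<phi> (W \<omega>) \<partial>M) = ennreal (prob E) * (\<integral>\<^sup>+\<omega>. \<phi> (W \<omega>) \<partial>M)"
proof -
  have "distr (density M (indicator E)) M' W = scale_measure (ennreal (prob E)) (distr M M' W)"
  proof (rule measure_eqI)
    fix A assume "A \<in> sets (distr (density M (indicator E)) M' W)"
    then have A: "A \<in> sets M'" "W -` A \<inter> space M \<in> events" using W by (auto simp: measurable_sets)
    have "emeasure (distr (density M (indicator E)) M' W) A = (\<integral>\<^sup>+\<omega>. indicator E \<omega> * indicator (W -` A \<inter> space M) \<omega> \<partial>M)"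
      using A W E by (simp add: emeasure_distr emeasure_density)
    also have "\<dots> = emeasure M (E \<inter> (W -` A \<inter> space M))"
      using A E by (simp add: indicator_inter_arith[symmetric])
    also have "\<dots> = ennreal (prob E) * emeasure M (W -` A \<inter> space M)"
      by (simp add: emeasure_eq_measure indep[OF A(1)] ennreal_mult)
    finally show "emeasure (distr (density M (indicator E)) M' W) A =
        emeasure (scale_measure (ennreal (prob E)) (distr M M' W)) A"
      using A W by (simp add: emeasure_distr)
  qed simp
  then have "(\<integral>\<^sup>+s. \<phi> s \<partial>distr (density M (indicator E)) M' W) = (\<integral>\<^sup>+s. \<phi> s \<partial>scale_measure (ennreal (prob E)) (distr M M' W))"
    by simp
  then show ?thesis
    using W E \<phi> by (simp add: nn_integral_distr nn_integral_scale_measure nn_integral_density)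
qed

text \<open>Conditioning on a discrete variable that is independent of \<open>W\<close>. The independence
  is assumed for events, so that \<open>Z\<close> and \<open>W\<close> may have values in
  different types.\<close>
lemma (in prob_space) nn_integral_indep_nat:
  assumes Z: "Z \<in> measurable M (count_space UNIV)" and W: "W \<in> measurable M M'"
    and indep: "\<And>k A. A \<in> sets M' \<Longrightarrow>
      prob ({\<omega>\<in>space M. Z \<omega> = (k::nat)} \<inter> (W -` A \<inter> space M)) =
      prob {\<omega>\<in>space M. Z \<omega> = k} * prob (W -` A \<inter> space M)"
    and \<phi>: "\<And>k. \<phi> k \<in> borel_measurable M'"
  shows "(\<integral>\<^sup>+\<omega>. \<phi> (Z \<omega>) (W \<omega>) \<partial>M) =
    (\<Sum>k. ennreal (prob {\<omega>\<in>space M. Z \<omega> = k}) * (\<integral>\<^sup>+\<omega>. \<phi> k (W \<omega>) \<partial>M))"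
proof -
  have E: "{\<omega>\<in>space M. Z \<omega> = k} \<in> events" for k using Z by measurable
  have "(\<integral>\<^sup>+\<omega>. \<phi> (Z \<omega>) (W \<omega>) \<partial>M) =
      (\<integral>\<^sup>+\<omega>. (\<Sum>k. indicator {\<omega>\<in>space M. Z \<omega> = k} \<omega> * \<phi> k (W \<omega>)) \<partial>M)"
  proof (rule nn_integral_cong)
    fix \<omega> assume "\<omega> \<in> space M"
    then show "\<phi> (Z \<omega>) (W \<omega>) = (\<Sum>k. indicator {\<omega>\<in>space M. Z \<omega> = k} \<omega> * \<phi> k (W \<omega>))"
      by (subst suminf_finite[of "{Z \<omega>}"]) auto
  qed
  also have "\<dots> = (\<Sum>k. \<integral>\<^sup>+\<omega>. indicator {\<omega>\<in>space M. Z \<omega> = k} \<omega> * \<phi> k (W \<omega>) \<partial>M)"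
    by (intro nn_integral_suminf borel_measurable_times_ennreal borel_measurable_indicator E measurable_compose[OF W \<phi>])
  also have "\<dots> = (\<Sum>k. ennreal (prob {\<omega>\<in>space M. Z \<omega> = k}) * (\<integral>\<^sup>+\<omega>. \<phi> k (W \<omega>) \<partial>M))"
    by (intro suminf_cong nn_integral_indicator_indep[OF E W indep \<phi>])
  finally show ?thesis .
qed

lemma measurable_fun_component:
  assumes "D \<in> measurable S T" "i \<in> I"
  shows "(\<lambda>s. D (s i)) \<in> measurable (PiM I (\<lambda>_. S)) T"
  using measurable_compose[where f = "\<lambda>s. s i" and g = D, OF measurable_component_singleton assms(1)] assms(2)
  by blast

lemma (in prob_space) indep_vars_split:
  assumes ind: "indep_vars (\<lambda>_. S) Y I" and "k \<in> I" "J \<subseteq> I" "k \<notin> J"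
    and D: "D \<in> measurable S (count_space UNIV)" and A: "A \<in> sets (PiM J (\<lambda>_. S))"
  shows "prob ({\<omega>\<in>space M. D (Y k \<omega>) = c} \<inter> ((\<lambda>\<omega>. restrict (\<lambda>i. Y i \<omega>) J) -` A \<inter> space M)) =
    prob {\<omega>\<in>space M. D (Y k \<omega>) = c} * prob ((\<lambda>\<omega>. restrict (\<lambda>i. Y i \<omega>) J) -` A \<inter> space M)"
proof -
  have Y: "Y k \<in> measurable M S" using ind \<open>k \<in> I\<close> by (auto simp: indep_vars_def)
  have *: "indep_var (PiM {k} (\<lambda>_. S)) (\<lambda>\<omega>. restrict (\<lambda>i. Y i \<omega>) {k}) (PiM J (\<lambda>_. S)) (\<lambda>\<omega>. restrict (\<lambda>i. Y i \<omega>) J)"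
    using assms by (intro indep_var_restrict[OF ind]) auto
  let ?A = "(\<lambda>s. D (s k)) -` {c} \<inter> space (PiM {k} (\<lambda>_. S))"
  have "(\<lambda>s. D (s k)) \<in> measurable (PiM {k} (\<lambda>_. S)) (count_space UNIV)"
    by (rule measurable_fun_component[OF D]) simp
  then have "?A \<in> sets (PiM {k} (\<lambda>_. S))" by (rule measurable_sets) simp
  moreover have "(\<lambda>\<omega>. restrict (\<lambda>i. Y i \<omega>) {k}) -` ?A \<inter> space M = {\<omega>\<in>space M. D (Y k \<omega>) = c}"
    using measurable_space[OF Y] by (auto simp: space_PiM)
  moreover have "(\<lambda>\<omega>. (restrict (\<lambda>i. Y i \<omega>) {k}, restrict (\<lambda>i. Y i \<omega>) J)) -` (?A \<times> A) \<inter> space M =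
     ((\<lambda>\<omega>. restrict (\<lambda>i. Y i \<omega>) {k}) -` ?A \<inter> space M) \<inter> ((\<lambda>\<omega>. restrict (\<lambda>i. Y i \<omega>) J) -` A \<inter> space M)"
    by auto
  ultimately show ?thesis
    using indep_varD[OF * _ A, of ?A] by simp
qed

text \<open>There are only countably many vectors of fixed finite length over the natural numbers, so the
  function \<open>v\<close> may be arbitrary.\<close>
lemma measurable_fun_of_nat_vector:
  fixes D :: "nat \<Rightarrow> 's \<Rightarrow> nat" and v :: "(nat \<Rightarrow> nat) \<Rightarrow> ennreal"
  assumes "\<And>j. j < k \<Longrightarrow> D j \<in> measurable S (count_space UNIV)"
  shows "(\<lambda>s. v (\<lambda>j\<in>{..<k}. D j s)) \<in> borel_measurable S"
proof (rule measurable_compose[where f = "\<lambda>s. \<lambda>j\<in>{..<k}. D j s" and g = v])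
  have "PiM {..<k} (\<lambda>_. count_space UNIV) = count_space (PiE {..<k} (\<lambda>_. UNIV :: nat set))"
    by (rule count_space_PiM_finite) auto
  then show "v \<in> borel_measurable (PiM {..<k} (\<lambda>_. count_space UNIV))" by simp
  show "(\<lambda>s. \<lambda>j\<in>{..<k}. D j s) \<in> measurable S (PiM {..<k} (\<lambda>_. count_space UNIV))"
    using assms by (intro measurable_restrict) auto
qed

text \<open>The number of the first \<open>k\<close> points of the sequence \<open>s\<close> that lie in
  cell \<open>i\<close>, where \<open>C\<close> assigns to each position its cell.\<close>
definition occupancy :: "('a \<Rightarrow> nat) \<Rightarrow> nat \<Rightarrow> (nat \<Rightarrow> 'a) \<Rightarrow> nat \<Rightarrow> nat" where
  "occupancy C k s i = card {j. j < k \<and> C (s j) = i}"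

lemma occupancy_restrict: "occupancy C k (restrict s {..<k}) = occupancy C k s"
  by (auto simp: occupancy_def fun_eq_iff intro!: arg_cong[where f = card])

lemma occupancy_Suc:
  "occupancy C (Suc k) s = (occupancy C k s)(C (s k) := Suc (occupancy C k s (C (s k))))"
proof
  fix i
  have "{j. j < Suc k \<and> C (s j) = i} = (if C (s k) = i then {k} else {}) \<union> {j. j < k \<and> C (s j) = i}"
    by (auto simp: less_Suc_eq)
  then show "occupancy C (Suc k) s i = ((occupancy C k s)(C (s k) := Suc (occupancy C k s (C (s k))))) i"
    by (auto simp: occupancy_def)
qed

lemma measurable_occupancy:
  fixes v :: "(nat \<Rightarrow> nat) \<Rightarrow> ennreal"
  assumes C: "C \<in> measurable S (count_space UNIV)" and "{..<k} \<subseteq> I"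
  shows "(\<lambda>s. v (occupancy C k s)) \<in> borel_measurable (PiM I (\<lambda>_. S))"
proof -
  have "(\<lambda>s. C (s j)) \<in> measurable (PiM I (\<lambda>_. S)) (count_space UNIV)" if "j < k" for j
    using that assms by (intro measurable_fun_component[OF C]) auto
  then have "(\<lambda>s. (\<lambda>t. v (occupancy (\<lambda>c. c) k t)) (\<lambda>j\<in>{..<k}. C (s j))) \<in> borel_measurable (PiM I (\<lambda>_. S))"
    by (rule measurable_fun_of_nat_vector)
  moreover have "occupancy (\<lambda>c. c) k (\<lambda>j\<in>{..<k}. C (s j)) = occupancy C k s" for s
    unfolding occupancy_restrict by (simp add: occupancy_def fun_eq_iff)
  ultimately show ?thesis by simp
qed

text \<open>Conditioning on the cell of the last point turns one point into one application of the
  averaging operator. The starting vector \<open>x\<close> has to vary in the induction.\<close>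
lemma (in prob_space) expectation_occupancy:
  fixes X :: "nat \<Rightarrow> 'a \<Rightarrow> 'b::topological_space"
  assumes ind: "indep_vars (\<lambda>_. borel) X UNIV" and F: "\<And>i. distr M borel (X i) = F"
    and C: "C \<in> measurable borel (count_space UNIV)" "\<And>x. C x < m"
    and u: "\<And>x. 0 \<le> u x"
  shows "(\<integral>\<^sup>+\<omega>. ennreal (u (\<lambda>i. x i + occupancy C k (\<lambda>j. X j \<omega>) i)) \<partial>M) =
    ennreal ((shift_avg (\<lambda>c. measure F (C -` {c})) m ^^ k) u x)"
proof (induction k arbitrary: x)
  case 0
  show ?case by (simp add: occupancy_def emeasure_space_1)
next
  case (Suc k)
  let ?w = "\<lambda>c. measure F (C -` {c})"
  let ?T = "shift_avg ?w m"
  have X: "X j \<in> borel_measurable M" for j using ind by (auto simp: indep_vars_def)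
  define \<phi> where "\<phi> c s = ennreal (u (\<lambda>i. (x(c := Suc (x c))) i + occupancy C k s i))" for c s
  let ?W = "\<lambda>\<omega>. restrict (\<lambda>i. X i \<omega>) {..<k}"
  have w: "prob {\<omega>\<in>space M. C (X k \<omega>) = c} = ?w c" for c
  proof -
    have "measure (distr M borel (X k)) (C -` {c}) = prob (X k -` (C -` {c}) \<inter> space M)"
      using measurable_sets[OF C(1), of "{c}"] by (intro measure_distr X) simp
    then show ?thesis unfolding F by (simp add: vimage_def Int_def conj_commute)
  qed
  have "(\<integral>\<^sup>+\<omega>. ennreal (u (\<lambda>i. x i + occupancy C (Suc k) (\<lambda>j. X j \<omega>) i)) \<partial>M) = (\<integral>\<^sup>+\<omega>. \<phi> (C (X k \<omega>)) (?W \<omega>) \<partial>M)"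
    unfolding \<phi>_def occupancy_restrict
    by (intro nn_integral_cong arg_cong[where f = "\<lambda>y. ennreal (u y)"]) (auto simp: occupancy_Suc)
  also have "\<dots> = (\<Sum>c. ennreal (prob {\<omega>\<in>space M. C (X k \<omega>) = c}) * (\<integral>\<^sup>+\<omega>. \<phi> c (?W \<omega>) \<partial>M))"
  proof (rule nn_integral_indep_nat[where \<phi> = \<phi> and W = ?W and M' = "PiM {..<k} (\<lambda>_. borel)"])
    show "(\<lambda>\<omega>. C (X k \<omega>)) \<in> measurable M (count_space UNIV)" by (rule measurable_compose[OF X C(1)])
    show "?W \<in> measurable M (PiM {..<k} (\<lambda>_. borel))" using X by (intro measurable_restrict)
    show "\<phi> c \<in> borel_measurable (PiM {..<k} (\<lambda>_. borel))" for c
      unfolding \<phi>_def by (rule measurable_occupancy[OF C(1) order_refl])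
    show "prob ({\<omega>\<in>space M. C (X k \<omega>) = c} \<inter> (?W -` A \<inter> space M)) =
      prob {\<omega>\<in>space M. C (X k \<omega>) = c} * prob (?W -` A \<inter> space M)"
      if "A \<in> sets (PiM {..<k} (\<lambda>_. borel))" for c A
      using that by (intro indep_vars_split[OF ind _ _ _ C(1)]) auto
  qed
  also have "\<dots> = (\<Sum>c. ennreal (?w c) * ennreal ((?T ^^ k) u (x(c := Suc (x c)))))"
    unfolding w \<phi>_def occupancy_restrict Suc by (rule refl)
  also have "\<dots> = (\<Sum>c<m. ennreal (?w c) * ennreal ((?T ^^ k) u (x(c := Suc (x c)))))"
  proof (rule suminf_finite)
    fix c assume "c \<notin> {..<m}"
    then have "C -` {c} = {}" using C(2) by auto
    then show "ennreal (?w c) * ennreal ((?T ^^ k) u (x(c := Suc (x c)))) = 0" by simp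
  qed simp
  also have "\<dots> = (\<Sum>c<m. ennreal (?w c * (?T ^^ k) u (x(c := Suc (x c)))))"
    by (intro sum.cong refl ennreal_mult[symmetric] shift_avg_iter_nonneg u) simp_all
  also have "\<dots> = ennreal ((?T ^^ Suc k) u x)"
    by (simp add: sum_ennreal shift_avg_iter_nonneg u shift_avg_def[of _ _ "(?T ^^ k) u"])
  finally show ?case .
qed

lemma (in prob_space) expectation_mixed_occupancy:
  fixes X :: "nat \<Rightarrow> 'a \<Rightarrow> 'b::topological_space"
  assumes ind: "indep_vars (\<lambda>_. borel) X UNIV" and F: "\<And>i. distr M borel (X i) = F"
    and \<tau>: "\<tau> \<in> measurable M (count_space UNIV)"
    and ind\<tau>: "indep_set (sets (vimage_algebra (space M) \<tau> (count_space UNIV)))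
       (sets (vimage_algebra (space M) (\<lambda>\<omega> i. X i \<omega>) (PiM UNIV (\<lambda>_. borel))))"
    and C: "C \<in> measurable borel (count_space UNIV)" "\<And>x. C x < m"
    and u: "\<And>x. 0 \<le> u x"
  shows "(\<integral>\<^sup>+\<omega>. ennreal (u (occupancy C (\<tau> \<omega>) (\<lambda>j. X j \<omega>))) \<partial>M) =
    (\<Sum>k. ennreal (prob {\<omega>\<in>space M. \<tau> \<omega> = k} * (shift_avg (\<lambda>c. measure F (C -` {c})) m ^^ k) u (\<lambda>_. 0)))"
proof -
  have X: "X j \<in> borel_measurable M" for j using ind by (auto simp: indep_vars_def)
  have "(\<integral>\<^sup>+\<omega>. ennreal (u (occupancy C (\<tau> \<omega>) (\<lambda>j. X j \<omega>))) \<partial>M) =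
    (\<Sum>k. ennreal (prob {\<omega>\<in>space M. \<tau> \<omega> = k}) * (\<integral>\<^sup>+\<omega>. ennreal (u (occupancy C k (\<lambda>j. X j \<omega>))) \<partial>M))"
  proof (rule nn_integral_indep_nat[OF \<tau>, where \<phi> = "\<lambda>k s. ennreal (u (occupancy C k s))"
      and M' = "PiM UNIV (\<lambda>_. borel)"])
    show "(\<lambda>\<omega> j. X j \<omega>) \<in> measurable M (PiM UNIV (\<lambda>_. borel))"
    proof -
      have "(\<lambda>\<omega>. \<lambda>j\<in>UNIV. X j \<omega>) \<in> measurable M (PiM UNIV (\<lambda>_. borel))"
        by (intro measurable_restrict X)
      then show ?thesis by (simp only: restrict_UNIV)
    qed
    show "(\<lambda>s. ennreal (u (occupancy C k s))) \<in> borel_measurable (PiM UNIV (\<lambda>_. borel))" for k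
      by (rule measurable_occupancy[OF C(1) subset_UNIV])
    fix k and A :: "(nat \<Rightarrow> 'b) set" assume "A \<in> sets (PiM UNIV (\<lambda>_. borel))"
    then have A: "(\<lambda>\<omega> j. X j \<omega>) -` A \<inter> space M \<in> sets (vimage_algebra (space M) (\<lambda>\<omega> i. X i \<omega>) (PiM UNIV (\<lambda>_. borel)))"
      by (rule in_vimage_algebra)
    have k: "\<tau> -` {k} \<inter> space M \<in> sets (vimage_algebra (space M) \<tau> (count_space UNIV))"
      by (rule in_vimage_algebra) simp
    have "\<tau> -` {k} \<inter> space M = {\<omega>\<in>space M. \<tau> \<omega> = k}" by auto
    with indep_setD[OF ind\<tau> k A] show "prob ({\<omega>\<in>space M. \<tau> \<omega> = k} \<inter> ((\<lambda>\<omega> j. X j \<omega>) -` A \<inter> space M)) =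
      prob {\<omega>\<in>space M. \<tau> \<omega> = k} * prob ((\<lambda>\<omega> j. X j \<omega>) -` A \<inter> space M)"
      by (simp only:)
  qed
  also have "\<dots> = (\<Sum>k. ennreal (prob {\<omega>\<in>space M. \<tau> \<omega> = k}) *
      ennreal ((shift_avg (\<lambda>c. measure F (C -` {c})) m ^^ k) u (\<lambda>_. 0)))"
    using expectation_occupancy[OF ind F C, where u = u and x = "\<lambda>_. 0"] u by simp
  finally show ?thesis
    by (simp add: ennreal_mult shift_avg_iter_nonneg u)
qed

text \<open>Cells are added one by one: conditioning on the count in cell \<open>m\<close> produces exactly
  the sum by which the exponential series for \<open>m + 1\<close> cells is obtained from the one
  for \<open>m\<close> cells.\<close>
lemma (in prob_space) expectation_indep_poisson:
  fixes Y :: "nat \<Rightarrow> 'a \<Rightarrow> ennreal"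
  assumes ind: "indep_vars (\<lambda>_. S) Y {..<n}" and D: "D \<in> measurable S (count_space UNIV)"
    and law: "\<And>i k. i < n \<Longrightarrow> prob {\<omega>\<in>space M. D (Y i \<omega>) = k} = poisson_weight (r * w i) k"
    and w: "\<And>i. 0 \<le> w i" and "0 \<le> r" and u: "\<And>x. 0 \<le> u x"
    and "m \<le> n"
  shows "(\<integral>\<^sup>+\<omega>. ennreal (u (\<lambda>i. x i + (if i < m then D (Y i \<omega>) else 0))) \<partial>M) =
    ennreal (exp (- (r * (\<Sum>i<m. w i)))) * (\<Sum>k. ennreal (r ^ k / fact k * (shift_avg w m ^^ k) u x))"
  using \<open>m \<le> n\<close>
proof (induction m arbitrary: x)
  case 0
  have "r ^ k / fact k * (shift_avg w 0 ^^ k) u x = (if k = 0 then u x else 0)" for k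
    by (cases k) (simp_all add: shift_avg_def)
  then have "(\<Sum>k. ennreal (r ^ k / fact k * (shift_avg w 0 ^^ k) u x)) = ennreal (u x)"
    by (subst suminf_finite[of "{0}"]) simp_all
  then show ?case by (simp add: emeasure_space_1)
next
  case (Suc m)
  then have "m < n" by simp
  have Y: "Y i \<in> measurable M S" if "i < n" for i using ind that by (auto simp: indep_vars_def)
  define \<phi> where "\<phi> j s = ennreal (u (\<lambda>i. (x(m := x m + j)) i + (if i < m then D (s i) else 0)))" for j s
  let ?W = "\<lambda>\<omega>. restrict (\<lambda>i. Y i \<omega>) {..<m}"
  have \<phi>W: "\<phi> j (?W \<omega>) = ennreal (u (\<lambda>i. (x(m := x m + j)) i + (if i < m then D (Y i \<omega>) else 0)))" for j \<omega>
    unfolding \<phi>_def by (intro arg_cong[where f = "\<lambda>y. ennreal (u y)"]) auto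
  have "(\<integral>\<^sup>+\<omega>. ennreal (u (\<lambda>i. x i + (if i < Suc m then D (Y i \<omega>) else 0))) \<partial>M) = (\<integral>\<^sup>+\<omega>. \<phi> (D (Y m \<omega>)) (?W \<omega>) \<partial>M)"
    unfolding \<phi>W by (intro nn_integral_cong arg_cong[where f = "\<lambda>y. ennreal (u y)"]) auto
  also have "\<dots> = (\<Sum>j. ennreal (prob {\<omega>\<in>space M. D (Y m \<omega>) = j}) * (\<integral>\<^sup>+\<omega>. \<phi> j (?W \<omega>) \<partial>M))"
  proof (rule nn_integral_indep_nat[where \<phi> = \<phi> and W = ?W and M' = "PiM {..<m} (\<lambda>_. S)"])
    show "(\<lambda>\<omega>. D (Y m \<omega>)) \<in> measurable M (count_space UNIV)"
      by (rule measurable_compose[OF Y[OF \<open>m < n\<close>] D])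
    show "?W \<in> measurable M (PiM {..<m} (\<lambda>_. S))" using Y \<open>m < n\<close> by (intro measurable_restrict) auto
    show "\<phi> j \<in> borel_measurable (PiM {..<m} (\<lambda>_. S))" for j
    proof -
      have "(\<lambda>s. D (s i)) \<in> measurable (PiM {..<m} (\<lambda>_. S)) (count_space UNIV)" if "i < m" for i
        using that by (intro measurable_fun_component[OF D]) auto
      then have "(\<lambda>s. (\<lambda>t. ennreal (u (\<lambda>i. (x(m := x m + j)) i + (if i < m then t i else 0)))) (\<lambda>i\<in>{..<m}. D (s i)))
          \<in> borel_measurable (PiM {..<m} (\<lambda>_. S))"
        by (rule measurable_fun_of_nat_vector)
      moreover have "(\<lambda>i. (x(m := x m + j)) i + (if i < m then (\<lambda>i\<in>{..<m}. D (s i)) i else 0)) =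
         (\<lambda>i. (x(m := x m + j)) i + (if i < m then D (s i) else 0))" for s
        by auto
      ultimately show ?thesis unfolding \<phi>_def by simp
    qed
    show "prob ({\<omega>\<in>space M. D (Y m \<omega>) = j} \<inter> (?W -` A \<inter> space M)) =
      prob {\<omega>\<in>space M. D (Y m \<omega>) = j} * prob (?W -` A \<inter> space M)"
      if "A \<in> sets (PiM {..<m} (\<lambda>_. S))" for j A
      using that \<open>m < n\<close> by (intro indep_vars_split[OF ind _ _ _ D]) auto
  qed
  also have "\<dots> = (\<Sum>j. ennreal (poisson_weight (r * w m) j) *
      (ennreal (exp (- (r * (\<Sum>i<m. w i)))) * (\<Sum>k. ennreal (r ^ k / fact k * (shift_avg w m ^^ k) u (x(m := x m + j))))))"
    unfolding law[OF \<open>m < n\<close>] \<phi>W Suc.IH[OF less_imp_le[OF \<open>m < n\<close>]] by (rule refl)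
  also have "\<dots> = (\<Sum>j. ennreal (exp (- (r * (\<Sum>i<Suc m. w i)))) * (ennreal ((r * w m) ^ j / fact j) *
      (\<Sum>k. ennreal (r ^ k / fact k * (shift_avg w m ^^ k) u (x(m := x m + j))))))"
  proof (rule suminf_cong)
    fix j
    have "exp (- (r * (\<Sum>i<Suc m. w i))) = exp (- (r * w m)) * exp (- (r * (\<Sum>i<m. w i)))"
      by (simp add: exp_add[symmetric] algebra_simps)
    then have "poisson_weight (r * w m) j * exp (- (r * (\<Sum>i<m. w i))) =
        exp (- (r * (\<Sum>i<Suc m. w i))) * ((r * w m) ^ j / fact j)"
      by (simp only: poisson_weight_def mult_ac)
    then have "ennreal (poisson_weight (r * w m) j) * ennreal (exp (- (r * (\<Sum>i<m. w i)))) =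
      ennreal (exp (- (r * (\<Sum>i<Suc m. w i)))) * ennreal ((r * w m) ^ j / fact j)"
      using w \<open>0 \<le> r\<close> by (simp only: ennreal_mult[symmetric] poisson_weight_nonneg mult_nonneg_nonneg
          exp_ge_zero divide_nonneg_nonneg zero_le_power fact_ge_zero)
    then show "ennreal (poisson_weight (r * w m) j) *
        (ennreal (exp (- (r * (\<Sum>i<m. w i)))) * (\<Sum>k. ennreal (r ^ k / fact k * (shift_avg w m ^^ k) u (x(m := x m + j)))))
      = ennreal (exp (- (r * (\<Sum>i<Suc m. w i)))) * (ennreal ((r * w m) ^ j / fact j) *
        (\<Sum>k. ennreal (r ^ k / fact k * (shift_avg w m ^^ k) u (x(m := x m + j)))))"
      by (simp only: mult.assoc[symmetric])
  qed
  also have "\<dots> = ennreal (exp (- (r * (\<Sum>i<Suc m. w i)))) *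
      (\<Sum>k. ennreal (r ^ k / fact k * (shift_avg w (Suc m) ^^ k) u x))"
    unfolding ennreal_suminf_cmult using shift_avg_exp_series[OF w u \<open>0 \<le> r\<close>] by simp
  finally show ?case .
qed

text \<open>The last cell is the part of the space outside the sets that are observed. Summing its count
  out of a Poisson mixture leaves the expression obtained for independent Poisson counts in the
  other cells.\<close>
lemma poisson_mixture_residual_cell:
  assumes w: "\<And>i. 0 \<le> w i" "(\<Sum>i<Suc n. w i) = 1" and "0 \<le> r" and u: "\<And>x. 0 \<le> u x"
    and ignore: "\<And>x j. u (x(n := j)) = u x"
  shows "(\<Sum>k. ennreal (poisson_weight r k * (shift_avg w (Suc n) ^^ k) u x)) =
    ennreal (exp (- (r * (\<Sum>i<n. w i)))) * (\<Sum>k. ennreal (r ^ k / fact k * (shift_avg w n ^^ k) u x))"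
proof -
  let ?E = "\<Sum>k. ennreal (r ^ k / fact k * (shift_avg w n ^^ k) u x)"
  have "ennreal (poisson_weight r k * (shift_avg w (Suc n) ^^ k) u x) =
      ennreal (exp (- r)) * ennreal (r ^ k / fact k * (shift_avg w (Suc n) ^^ k) u x)" for k
    using \<open>0 \<le> r\<close> by (subst ennreal_mult[symmetric])
      (auto simp: poisson_weight_def shift_avg_iter_nonneg w u mult_ac)
  then have "(\<Sum>k. ennreal (poisson_weight r k * (shift_avg w (Suc n) ^^ k) u x)) =
      ennreal (exp (- r)) * (\<Sum>j. ennreal ((r * w n) ^ j / fact j) * ?E)"
    by (simp only: ennreal_suminf_cmult shift_avg_exp_series[OF w(1) u \<open>0 \<le> r\<close>] shift_avg_iter_fun_upd[of u, OF ignore])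
  also have "\<dots> = ennreal (exp (- r)) * ennreal (exp (r * w n)) * ?E"
    using exp_series_sums[of "r * w n"] w \<open>0 \<le> r\<close>
    by (subst ennreal_suminf_multc, subst suminf_ennreal_eq[of _ "exp (r * w n)"]) (simp_all add: mult.assoc)
  also have "ennreal (exp (- r)) * ennreal (exp (r * w n)) = ennreal (exp (- (r * (\<Sum>i<n. w i))))"
  proof -
    have "(\<Sum>i<n. w i) = 1 - w n" using w(2) by simp
    then have "- r + r * w n = - (r * (\<Sum>i<n. w i))" by (simp only: right_diff_distrib)
    then show ?thesis by (simp add: ennreal_mult[symmetric] exp_add[symmetric])
  qed
  finally show ?thesis .
qed

section \<open>Directionally convex functions of integer vectors\<close>

definition real_vec :: "nat \<Rightarrow> (nat \<Rightarrow> nat) \<Rightarrow> nat \<Rightarrow> real" where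
  "real_vec n x = (\<lambda>i\<in>{..<n}. real (x i))"

lemma real_vec_fun_upd: "i < n \<Longrightarrow> real_vec n (x(i := Suc (x i))) = (real_vec n x)(i := real_vec n x i + 1)"
  by (auto simp: real_vec_def fun_eq_iff)

lemma lattice_dcx_of_directionally_convex:
  assumes "directionally_convex n f"
  shows "lattice_dcx n (\<lambda>x. f (real_vec n x))"
  unfolding lattice_dcx_def
proof (intro allI impI)
  fix i j x assume "i < n" "j < n"
  have *: "f (real_vec n (x(i := Suc (x i)))) + f (real_vec n (x(j := Suc (x j)))) \<le>
     f (real_vec n x) + f (real_vec n ((x(j := Suc (x j)))(i := Suc ((x(j := Suc (x j))) i))))"
    if "i \<le> j" "j < n" for i j
  proof -
    have "i < n" using that by simp
    have "0 \<le> diff_op j 1 (diff_op i 1 f) (real_vec n x)"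
    proof -
      have "real_vec n x \<in> PiE {..<n} (\<lambda>_. UNIV)" by (auto simp: real_vec_def)
      then show ?thesis using assms that unfolding directionally_convex_def by (meson zero_less_one)
    qed
    then show ?thesis
      by (simp add: diff_op_def real_vec_fun_upd[OF \<open>i < n\<close>] real_vec_fun_upd[OF \<open>j < n\<close>] del: fun_upd_apply)
  qed
  have twist: "(x(j := Suc (x j)))(i := Suc ((x(j := Suc (x j))) i)) = (x(i := Suc (x i)))(j := Suc ((x(i := Suc (x i))) j))"
    by (auto simp: fun_eq_iff)
  show "f (real_vec n (x(i := Suc (x i)))) + f (real_vec n (x(j := Suc (x j)))) \<le>
     f (real_vec n x) + f (real_vec n ((x(i := Suc (x i)))(j := Suc ((x(i := Suc (x i))) j))))"
  proof (cases "i \<le> j")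
    case True
    then show ?thesis using *[of i j] \<open>j < n\<close> unfolding twist by simp
  next
    case False
    then show ?thesis using *[of j i] \<open>i < n\<close> by simp
  qed
qed

text \<open>Only finitely many coordinates have to be lowered to zero, one unit at a time.\<close>
lemma zero_coordinates_le:
  fixes h :: "(nat \<Rightarrow> nat) \<Rightarrow> real"
  assumes "\<And>i x. i < m \<Longrightarrow> h x \<le> h (x(i := Suc (x i)))"
  shows "h (\<lambda>i. if i < m then 0 else x i) \<le> h x"
  using assms
proof (induction m)
  case (Suc m)
  note step = Suc.prems
  let ?y = "\<lambda>i. if i < m then 0 else x i"
  have "h (?y(m := 0)) \<le> h (?y(m := k))" for k
  proof (induction k)
    case (Suc k)
    have "h (?y(m := k)) \<le> h (?y(m := Suc k))"
      using step[of m "?y(m := k)"] by (simp only: fun_upd_upd fun_upd_same lessI)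
    with Suc show ?case by (rule order_trans)
  qed (rule order_refl)
  from this[of "x m"] have "h (?y(m := 0)) \<le> h ?y" by (simp add: fun_upd_idem)
  also have "?y(m := 0) = (\<lambda>i. if i < Suc m then 0 else x i)" by (auto simp: less_Suc_eq)
  finally show ?case using Suc by fastforce
qed simp

text \<open>The affine function that agrees with \<open>f\<close> at the origin and at the unit vectors.\<close>
definition tangent :: "nat \<Rightarrow> ((nat \<Rightarrow> real) \<Rightarrow> real) \<Rightarrow> (nat \<Rightarrow> nat) \<Rightarrow> real" where
  "tangent n f x = f (real_vec n (\<lambda>_. 0)) +
     (\<Sum>i<n. real (x i) * (f (real_vec n ((\<lambda>_. 0)(i := 1))) - f (real_vec n (\<lambda>_. 0))))"

lemma tangent_fun_upd:
  assumes "i < n"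
  shows "tangent n f (x(i := Suc (x i))) =
    tangent n f x + (f (real_vec n ((\<lambda>_. 0)(i := 1))) - f (real_vec n (\<lambda>_. 0)))"
proof -
  let ?s = "\<lambda>i. f (real_vec n ((\<lambda>_. 0)(i := 1))) - f (real_vec n (\<lambda>_. 0))"
  have "(\<Sum>l<n. real ((x(i := Suc (x i))) l) * ?s l) = (\<Sum>l<n. real (x l) * ?s l + (if l = i then ?s l else 0))"
    by (intro sum.cong refl) (simp add: algebra_simps)
  also have "\<dots> = (\<Sum>l<n. real (x l) * ?s l) + ?s i" using assms by (simp add: sum.distrib)
  finally show ?thesis by (simp add: tangent_def)
qed

text \<open>By directional convexity the unit increments of \<open>f\<close> are smallest at the origin,
  where they are those of the affine function. Hence the difference is increasing in every
  coordinate and vanishes at the origin.\<close>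
lemma directionally_convex_above_tangent:
  assumes "directionally_convex n f"
  shows "tangent n f x \<le> f (real_vec n x)"
proof -
  let ?v = "\<lambda>x. f (real_vec n x)"
  have dcx: "?v (x(i := Suc (x i))) + ?v (x(j := Suc (x j))) \<le> ?v x + ?v ((x(j := Suc (x j)))(i := Suc ((x(j := Suc (x j))) i)))"
    if "i < n" "j < n" for i j x
    using lattice_dcx_of_directionally_convex[OF assms] that unfolding lattice_dcx_def
    by (metis (no_types, lifting) add.commute)
  define u where "u x = ?v x - tangent n f x" for x
  have incr: "u x \<le> u (x(i := Suc (x i)))" if "i < n" for i x
  proof -
    let ?h = "\<lambda>x. ?v (x(i := Suc (x i))) - ?v x"
    let ?z = "\<lambda>l. if l < n then 0 else x l"
    have "?h ?z \<le> ?h x"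
    proof (rule zero_coordinates_le)
      fix j x assume "j < n"
      then show "?h x \<le> ?h (x(j := Suc (x j)))" using dcx[OF \<open>i < n\<close>, of j x] by linarith
    qed
    moreover have "real_vec n ?z = real_vec n (\<lambda>_. 0)" "real_vec n (?z(i := Suc (?z i))) = real_vec n ((\<lambda>_. 0)(i := 1))"
      using that by (auto simp: real_vec_def fun_eq_iff)
    ultimately show ?thesis
      unfolding u_def tangent_fun_upd[OF that] by simp
  qed
  have "u (\<lambda>l. if l < n then 0 else x l) \<le> u x"
    by (rule zero_coordinates_le[OF incr])
  moreover have "real_vec n (\<lambda>l. if l < n then 0 else x l) = real_vec n (\<lambda>_. 0)"
    by (auto simp: real_vec_def fun_eq_iff)
  ultimately show ?thesis by (simp add: u_def tangent_def)
qed

text \<open>An affine function has vanishing second differences. One more coordinate, on which nothing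
  depends, is included because the points outside the observed sets are counted there.\<close>
lemma lattice_dcx_minus_tangent:
  assumes "directionally_convex n f"
  shows "lattice_dcx (Suc n) (\<lambda>x. f (real_vec n x) - tangent n f x)"
proof -
  let ?u = "\<lambda>x. f (real_vec n x) - tangent n f x"
  have ignore: "?u (x(n := k)) = ?u x" for x k
  proof -
    have "real_vec n (x(n := k)) = real_vec n x" "tangent n f (x(n := k)) = tangent n f x"
      by (auto simp: real_vec_def tangent_def fun_eq_iff)
    then show ?thesis by simp
  qed
  show ?thesis
    unfolding lattice_dcx_def
  proof (intro allI impI)
    fix i j x assume ij: "i < Suc n" "j < Suc n"
    consider "j = n" | "i = n" "j < n" | "i < n" "j < n" using ij by linarith
    then show "?u (x(i := Suc (x i))) + ?u (x(j := Suc (x j))) \<le>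
       ?u x + ?u ((x(i := Suc (x i)))(j := Suc ((x(i := Suc (x i))) j)))"
    proof cases
      case 1
      show ?thesis unfolding 1 ignore by simp
    next
      case 2
      have "(x(n := Suc (x n)))(j := Suc ((x(n := Suc (x n))) j)) = (x(j := Suc (x j)))(n := Suc (x n))"
        using 2 by (auto simp: fun_eq_iff)
      then show ?thesis unfolding 2 using ignore by simp
    next
      case 3
      then show ?thesis
        using lattice_dcx_of_directionally_convex[OF assms]
        unfolding lattice_dcx_def tangent_fun_upd[OF 3(1)] tangent_fun_upd[OF 3(2)]
        by (auto dest!: spec[of _ i] spec[of _ j] spec[of _ x] simp del: fun_upd_apply)
    qed
  qed
qed

lemma ext_expectation_add_integrable:
  fixes u l :: "'w \<Rightarrow> real"
  assumes u: "u \<in> borel_measurable M" "\<And>\<omega>. 0 \<le> u \<omega>" and l: "integrable M l"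
  shows "ext_expectation M (\<lambda>\<omega>. u \<omega> + l \<omega>) = enn2ereal (\<integral>\<^sup>+\<omega>. ennreal (u \<omega>) \<partial>M) + ereal (\<integral>\<omega>. l \<omega> \<partial>M)"
proof (cases "(\<integral>\<^sup>+\<omega>. ennreal (u \<omega>) \<partial>M) = top")
  case True
  have l_fin: "(\<integral>\<^sup>+\<omega>. ennreal \<bar>l \<omega>\<bar> \<partial>M) < top"
    using l by (simp add: integrable_iff_bounded)
  have "(\<integral>\<^sup>+\<omega>. ennreal (- (u \<omega> + l \<omega>)) \<partial>M) \<le> (\<integral>\<^sup>+\<omega>. ennreal \<bar>l \<omega>\<bar> \<partial>M)"
  proof (intro nn_integral_mono ennreal_leI)
    show "- (u \<omega> + l \<omega>) \<le> \<bar>l \<omega>\<bar>" for \<omega> using u(2)[of \<omega>] by linarith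
  qed
  then have neg: "(\<integral>\<^sup>+\<omega>. ennreal (- (u \<omega> + l \<omega>)) \<partial>M) < top" using l_fin by (rule le_less_trans)
  have "top = (\<integral>\<^sup>+\<omega>. ennreal (u \<omega>) \<partial>M)" using True by simp
  also have "\<dots> \<le> (\<integral>\<^sup>+\<omega>. ennreal (u \<omega> + l \<omega>) + ennreal \<bar>l \<omega>\<bar> \<partial>M)"
  proof (rule nn_integral_mono)
    fix \<omega>
    have "ennreal (u \<omega>) \<le> ennreal (max 0 (u \<omega> + l \<omega>) + \<bar>l \<omega>\<bar>)" by (intro ennreal_leI) linarith
    also have "\<dots> = ennreal (u \<omega> + l \<omega>) + ennreal \<bar>l \<omega>\<bar>" by (subst ennreal_plus) (auto simp: max_def ennreal_neg)
    finally show "ennreal (u \<omega>) \<le> ennreal (u \<omega> + l \<omega>) + ennreal \<bar>l \<omega>\<bar>" .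
  qed
  also have "\<dots> = (\<integral>\<^sup>+\<omega>. ennreal (u \<omega> + l \<omega>) \<partial>M) + (\<integral>\<^sup>+\<omega>. ennreal \<bar>l \<omega>\<bar> \<partial>M)"
    using u l by (intro nn_integral_add) auto
  finally have "(\<integral>\<^sup>+\<omega>. ennreal (u \<omega> + l \<omega>) \<partial>M) = top"
    using l_fin by (auto simp: top_unique)
  then show ?thesis using neg True
    by (cases "\<integral>\<^sup>+\<omega>. ennreal (- (u \<omega> + l \<omega>)) \<partial>M" rule: ennreal_cases) (simp_all add: ext_expectation_def enn2ereal_ennreal)
next
  case False
  then have ui: "integrable M u"
    using u by (intro integrableI_nonneg) (auto simp: top.not_eq_extremum)
  then have i: "integrable M (\<lambda>\<omega>. u \<omega> + l \<omega>)" using l by simp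
  have fin: "(\<integral>\<^sup>+\<omega>. ennreal (u \<omega> + l \<omega>) \<partial>M) \<noteq> top" "(\<integral>\<^sup>+\<omega>. ennreal (- (u \<omega> + l \<omega>)) \<partial>M) \<noteq> top"
    using real_integrable_def[of M "\<lambda>\<omega>. u \<omega> + l \<omega>"] i by simp_all
  have "ext_expectation M (\<lambda>\<omega>. u \<omega> + l \<omega>) = ereal (\<integral>\<omega>. u \<omega> + l \<omega> \<partial>M)"
    unfolding ext_expectation_def real_lebesgue_integral_def[OF i] using fin
    by (cases "\<integral>\<^sup>+\<omega>. ennreal (u \<omega> + l \<omega>) \<partial>M" rule: ennreal_cases;
        cases "\<integral>\<^sup>+\<omega>. ennreal (- (u \<omega> + l \<omega>)) \<partial>M" rule: ennreal_cases) (simp_all add: enn2ereal_ennreal)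
  also have "\<dots> = ereal ((\<integral>\<omega>. u \<omega> \<partial>M) + (\<integral>\<omega>. l \<omega> \<partial>M))" using ui l by simp
  finally show ?thesis
    using nn_integral_eq_integral[OF ui] u(2) by (simp add: enn2ereal_ennreal integral_nonneg)
qed

text \<open>Splitting off the affine minorant leaves a non-negative function; the affine part is integrable
  and its expectation depends on the means alone. So for count vectors with the same finite means
  it suffices to compare integrals of non-negative functions, even if an expectation is infinite.\<close>
lemma (in prob_space) ext_expectation_directionally_convex:
  assumes f: "directionally_convex n f" and meas: "(\<lambda>\<omega>. f (real_vec n (K \<omega>))) \<in> borel_measurable M"
    and K: "\<And>i. i < n \<Longrightarrow> (\<lambda>\<omega>. real (K \<omega> i)) \<in> borel_measurable M"
    and mean: "\<And>i. i < n \<Longrightarrow> (\<integral>\<^sup>+\<omega>. ennreal (real (K \<omega> i)) \<partial>M) = ennreal (a i)" "\<And>i. 0 \<le> a i"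
  shows "ext_expectation M (\<lambda>\<omega>. f (real_vec n (K \<omega>))) =
    enn2ereal (\<integral>\<^sup>+\<omega>. ennreal (f (real_vec n (K \<omega>)) - tangent n f (K \<omega>)) \<partial>M) +
    ereal (f (real_vec n (\<lambda>_. 0)) + (\<Sum>i<n. a i * (f (real_vec n ((\<lambda>_. 0)(i := 1))) - f (real_vec n (\<lambda>_. 0)))))"
proof -
  let ?s = "\<lambda>i. f (real_vec n ((\<lambda>_. 0)(i := 1))) - f (real_vec n (\<lambda>_. 0))"
  have "has_bochner_integral M (\<lambda>\<omega>. real (K \<omega> i)) (a i)" if "i < n" for i
    using that K mean by (intro has_bochner_integral_nn_integral) auto
  then have "has_bochner_integral M (\<lambda>\<omega>. \<Sum>i<n. real (K \<omega> i) * ?s i) (\<Sum>i<n. a i * ?s i)"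
    by (intro has_bochner_integral_sum has_bochner_integral_mult_left) auto
  then have t: "integrable M (\<lambda>\<omega>. tangent n f (K \<omega>))"
    "(\<integral>\<omega>. tangent n f (K \<omega>) \<partial>M) = f (real_vec n (\<lambda>_. 0)) + (\<Sum>i<n. a i * ?s i)"
    unfolding tangent_def by (simp_all add: has_bochner_integral_iff prob_space)
  have "ext_expectation M (\<lambda>\<omega>. (f (real_vec n (K \<omega>)) - tangent n f (K \<omega>)) + tangent n f (K \<omega>)) =
    enn2ereal (\<integral>\<^sup>+\<omega>. ennreal (f (real_vec n (K \<omega>)) - tangent n f (K \<omega>)) \<partial>M) + ereal (\<integral>\<omega>. tangent n f (K \<omega>) \<partial>M)"
    using t meas directionally_convex_above_tangent[OF f]
    by (intro ext_expectation_add_integrable) auto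
  then show ?thesis by (simp add: t)
qed

section \<open>Intensity of the sampled process and the cells of a partition\<close>

lemma emeasure_sampled_process_sum:
  fixes X :: "nat \<Rightarrow> 'w \<Rightarrow> 'a::metric_space"
  assumes "A \<in> sets borel"
  shows "emeasure (sampled_process \<tau> X \<omega>) A = (\<Sum>i<\<tau> \<omega>. indicator A (X i \<omega>))"
proof -
  let ?\<mu> = "\<lambda>B :: 'a set. \<Sum>i<\<tau> \<omega>. emeasure (return borel (X i \<omega>)) B"
  have "emeasure (sampled_process \<tau> X \<omega>) A = ?\<mu> A"
  proof (rule emeasure_measure_of[OF sampled_process_def])
    show "sets borel \<subseteq> Pow (UNIV :: 'a set)" by simp
    show "positive (sets (sampled_process \<tau> X \<omega>)) ?\<mu>" by (simp add: positive_def)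
    have sets: "sets (sampled_process \<tau> X \<omega>) = sets borel"
      unfolding sampled_process_def using sets.sets_measure_of_eq[of "borel :: 'a measure"] by simp
    then show "A \<in> sets (sampled_process \<tau> X \<omega>)" using assms by simp
    show "countably_additive (sets (sampled_process \<tau> X \<omega>)) ?\<mu>"
      unfolding sets
    proof (rule countably_additiveI)
      fix B :: "nat \<Rightarrow> 'a set" assume "range B \<subseteq> sets borel" "disjoint_family B"
      then have "(\<lambda>n. emeasure (return borel (X i \<omega>)) (B n)) sums emeasure (return borel (X i \<omega>)) (\<Union>n. B n)" for i
        by (intro sums_emeasure) auto
      then have "(\<lambda>n. ?\<mu> (B n)) sums ?\<mu> (\<Union>n. B n)"
        by (intro sums_sum)
      then show "(\<Sum>n. ?\<mu> (B n)) = ?\<mu> (\<Union>n. B n)" by (simp add: sums_iff)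
    qed
  qed
  then show ?thesis using assms by simp
qed

lemma emeasure_sampled_process:
  fixes X :: "nat \<Rightarrow> 'w \<Rightarrow> 'a::metric_space"
  assumes "A \<in> sets borel"
  shows "emeasure (sampled_process \<tau> X \<omega>) A = of_nat (card {j. j < \<tau> \<omega> \<and> X j \<omega> \<in> A})"
  by (simp add: emeasure_sampled_process_sum[OF assms] indicator_def sum.If_cases Int_def)

lemma measurable_emeasure_sampled_process:
  assumes "A \<in> sets borel" and "\<tau> \<in> measurable M (count_space UNIV)"
    and X: "\<And>i. X i \<in> borel_measurable M"
  shows "(\<lambda>\<omega>. emeasure (sampled_process \<tau> X \<omega>) A) \<in> borel_measurable M"
proof -
  have "(\<lambda>\<omega>. \<Sum>i<k. indicator A (X i \<omega>) :: ennreal) \<in> borel_measurable M" for k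
    using X assms(1) by measurable
  then have "(\<lambda>\<omega>. \<Sum>i<\<tau> \<omega>. indicator A (X i \<omega>) :: ennreal) \<in> borel_measurable M"
    using assms(2) by (rule measurable_compose_countable)
  then show ?thesis by (simp add: emeasure_sampled_process_sum[OF assms(1)])
qed

lemma emeasure_mean_measure:
  fixes \<eta> :: "'w \<Rightarrow> 'a::metric_space measure"
  assumes "\<And>B. B \<in> sets borel \<Longrightarrow> (\<lambda>\<omega>. emeasure (\<eta> \<omega>) B) \<in> borel_measurable M"
    and sets_\<eta>: "\<And>\<omega>. sets (\<eta> \<omega>) = sets borel" and "A \<in> sets borel"
  shows "emeasure (mean_measure M \<eta>) A = (\<integral>\<^sup>+\<omega>. emeasure (\<eta> \<omega>) A \<partial>M)"
proof (rule emeasure_measure_of[OF mean_measure_def])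
  let ?\<mu> = "\<lambda>B. \<integral>\<^sup>+\<omega>. emeasure (\<eta> \<omega>) B \<partial>M"
  show "sets borel \<subseteq> Pow (UNIV :: 'a set)" by simp
  show "positive (sets (mean_measure M \<eta>)) ?\<mu>" by (simp add: positive_def)
  have sets: "sets (mean_measure M \<eta>) = sets borel"
    unfolding mean_measure_def using sets.sets_measure_of_eq[of "borel :: 'a measure"] by simp
  then show "A \<in> sets (mean_measure M \<eta>)" using assms by simp
  show "countably_additive (sets (mean_measure M \<eta>)) ?\<mu>"
    unfolding sets
  proof (rule countably_additiveI)
    fix B :: "nat \<Rightarrow> 'a set" assume B: "range B \<subseteq> sets borel" "disjoint_family B"
    then have "(\<Sum>n. ?\<mu> (B n)) = (\<integral>\<^sup>+\<omega>. (\<Sum>n. emeasure (\<eta> \<omega>) (B n)) \<partial>M)"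
      using assms(1) by (intro nn_integral_suminf[symmetric]) auto
    also have "\<dots> = ?\<mu> (\<Union>n. B n)"
      using B by (intro nn_integral_cong suminf_emeasure) (auto simp: sets_\<eta>)
    finally show "(\<Sum>n. ?\<mu> (B n)) = ?\<mu> (\<Union>n. B n)" .
  qed
qed

lemma sum_measure_cells:
  assumes "prob_space F" "space F = UNIV" and C: "C \<in> measurable F (count_space UNIV)" "\<And>x. C x < (m::nat)"
  shows "(\<Sum>i<m. measure F (C -` {i})) = 1"
proof -
  interpret prob_space F by fact
  have "measure F (\<Union>i\<in>{..<m}. C -` {i}) = (\<Sum>i<m. measure F (C -` {i}))"
    using measurable_sets[OF C(1)] assms(2)
    by (intro finite_measure_finite_Union) (auto simp: disjoint_family_on_def)
  moreover have "(\<Union>i\<in>{..<m}. C -` {i}) = space F" using C(2) assms(2) by auto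
  ultimately show ?thesis using prob_space by simp
qed

text \<open>The value is \<open>E(\<tau>) * F A\<close>, but kept as a series since the mean of
  \<open>\<tau>\<close> is not yet known to be finite.\<close>
lemma (in prob_space) emeasure_mean_measure_mixed_sampled:
  fixes X :: "nat \<Rightarrow> 'a \<Rightarrow> 'b::metric_space"
  assumes mixed: "mixed_sampled_point_process M F \<tau> X \<eta>" and A: "A \<in> sets borel"
  shows "emeasure (mean_measure M \<eta>) A =
    (\<Sum>k. ennreal (prob {\<omega>\<in>space M. \<tau> \<omega> = k} * (real k * measure F A)))"
proof -
  note mixed = mixed[unfolded mixed_sampled_point_process_def]
  have X: "X i \<in> borel_measurable M" for i using mixed by (auto simp: indep_vars_def)
  have \<eta>: "\<eta> = sampled_process \<tau> X" using mixed by simp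
  interpret F: prob_space F using prob_space_distr[OF X[of 0]] mixed by simp
  have spF: "space F = UNIV" "sets F = sets borel" using mixed by (auto dest!: spec[of _ 0])
  define C where "C x = (if x \<in> A then 0 else Suc 0)" for x :: 'b
  have C: "C \<in> measurable borel (count_space UNIV)" unfolding C_def using A by measurable
  have C_vimage: "C -` {0} = A" by (auto simp: C_def split: if_splits)
  have sum: "(\<Sum>i<2. measure F (C -` {i})) = 1"
    using C spF by (intro sum_measure_cells[OF F.prob_space_axioms]) (auto simp: C_def cong: measurable_cong_sets)
  have "emeasure (mean_measure M \<eta>) A = (\<integral>\<^sup>+\<omega>. emeasure (\<eta> \<omega>) A \<partial>M)"
  proof (rule emeasure_mean_measure)
    show "(\<lambda>\<omega>. emeasure (\<eta> \<omega>) B) \<in> borel_measurable M" if "B \<in> sets borel" for B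
      unfolding \<eta> using that mixed X by (intro measurable_emeasure_sampled_process) auto
    show "sets (\<eta> \<omega>) = sets borel" for \<omega>
      unfolding \<eta> sampled_process_def using sets.sets_measure_of_eq[of "borel :: 'b measure"] by simp
  qed (rule A)
  also have "\<dots> = (\<integral>\<^sup>+\<omega>. ennreal (real (occupancy C (\<tau> \<omega>) (\<lambda>j. X j \<omega>) 0)) \<partial>M)"
  proof (rule nn_integral_cong)
    fix \<omega>
    have "C (X j \<omega>) = 0 \<longleftrightarrow> X j \<omega> \<in> A" for j by (simp add: C_def)
    then show "emeasure (\<eta> \<omega>) A = ennreal (real (occupancy C (\<tau> \<omega>) (\<lambda>j. X j \<omega>) 0))"
      unfolding \<eta> emeasure_sampled_process[OF A] occupancy_def by (simp add: ennreal_of_nat_eq_real_of_nat)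
  qed
  also have "\<dots> = (\<Sum>k. ennreal (prob {\<omega>\<in>space M. \<tau> \<omega> = k} *
      (shift_avg (\<lambda>c. measure F (C -` {c})) 2 ^^ k) (\<lambda>x. real (x 0)) (\<lambda>_. 0)))"
    using mixed by (intro expectation_mixed_occupancy C) (auto simp: C_def)
  also have "\<dots> = (\<Sum>k. ennreal (prob {\<omega>\<in>space M. \<tau> \<omega> = k} * (real k * measure F A)))"
    by (subst shift_avg_iter_coordinate[OF sum]) (simp_all add: C_vimage)
  finally show ?thesis .
qed

lemma sums_of_suminf_ennreal:
  assumes "\<And>k. 0 \<le> a k" "(\<Sum>k. ennreal (a k)) < top"
  shows "a sums enn2real (\<Sum>k. ennreal (a k))"
proof -
  have "summable a" using assms by (intro summable_suminf_not_top) auto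
  then show ?thesis using assms by (simp add: suminf_ennreal2 suminf_nonneg summable_sums)
qed

lemma exists_bounded_positive:
  fixes F :: "'b::metric_space measure"
  assumes "prob_space F" "sets F = sets borel"
  obtains A where "A \<in> sets borel" "bounded A" "0 < measure F A"
proof -
  interpret F: prob_space F by fact
  have sp: "space F = UNIV" using sets_eq_imp_space_eq[OF assms(2)] by simp
  obtain x :: 'b where True by simp
  have U: "(\<Union>k. ball x (real k)) = UNIV"
    using reals_Archimedean2 by (auto simp: set_eq_iff)
  have "\<exists>k. measure F (ball x (real k)) \<noteq> 0"
  proof (rule ccontr)
    assume "\<not> ?thesis"
    then have "emeasure F (\<Union>k. ball x (real k)) = 0"
      using assms(2) by (intro emeasure_UN_eq_0) (auto simp: F.emeasure_eq_measure)
    then show False using F.emeasure_space_1 U sp by simp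
  qed
  then obtain k where "measure F (ball x (real k)) \<noteq> 0" by auto
  then show thesis by (intro that[of "ball x (real k)"]) (auto simp: zero_less_measure_iff)
qed

text \<open>Positions outside all of the first \<open>n\<close> sets are assigned to the residual cell
  \<open>n\<close>.\<close>
definition cell_index :: "nat \<Rightarrow> (nat \<Rightarrow> 'a set) \<Rightarrow> 'a \<Rightarrow> nat" where
  "cell_index n B x = (LEAST i. i = n \<or> x \<in> B i)"

lemma cell_index_less: "cell_index n B x < Suc n"
  unfolding cell_index_def less_Suc_eq_le by (rule Least_le) simp

lemma cell_index_eq_iff:
  assumes "disjoint_family_on B {..<n}" "i < n"
  shows "cell_index n B x = i \<longleftrightarrow> x \<in> B i"
proof
  assume "cell_index n B x = i"
  then show "x \<in> B i"
    using LeastI[of "\<lambda>i. i = n \<or> x \<in> B i" n] assms by (auto simp: cell_index_def)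
next
  assume x: "x \<in> B i"
  show "cell_index n B x = i"
    unfolding cell_index_def
  proof (rule Least_equality)
    fix j assume "j = n \<or> x \<in> B j"
    then show "i \<le> j" using x assms unfolding disjoint_family_on_def
      by (metis disjoint_iff lessThan_iff less_imp_le_nat not_le_imp_less order_less_trans)
  qed (use x in simp)
qed

lemma measurable_cell_index:
  assumes "\<And>i. i < n \<Longrightarrow> B i \<in> sets S" "disjoint_family_on B {..<n}" "space S = UNIV"
  shows "cell_index n B \<in> measurable S (count_space UNIV)"
proof -
  have lt: "cell_index n B -` {i} \<in> sets S" if "i < n" for i
  proof -
    have "cell_index n B -` {i} = B i" using cell_index_eq_iff[OF assms(2) that] by auto
    then show ?thesis using assms that by simp
  qed
  moreover have "cell_index n B -` {n} \<in> sets S"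
  proof -
    have "cell_index n B -` {n} = space S - (\<Union>i<n. cell_index n B -` {i})"
    proof -
      have "cell_index n B x = n \<or> cell_index n B x < n" for x
        using cell_index_less[of n B x] by linarith
      then show ?thesis unfolding assms(3) by (auto simp: less_imp_neq)
    qed
    then show ?thesis using lt by auto
  qed
  moreover have "cell_index n B -` {i} = {}" if "n < i" for i
    using cell_index_less[of n B] that by (auto simp: less_Suc_eq_le not_less[symmetric])
  ultimately have "cell_index n B -` {i} \<in> sets S" for i
    by (metis linorder_neqE_nat sets.empty_sets)
  then show ?thesis using assms(3) by (simp add: measurable_count_space_eq_countable)
qed

section \<open>The comparison theorem\<close>

theorem proposition4p9:
  fixes M :: "'w measure" and N :: "'v measure"
    and F :: "'a::polish_space measure"
    and \<tau> :: "'w \<Rightarrow> nat" and X :: "nat \<Rightarrow> 'w \<Rightarrow> 'a"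
    and \<eta>\<^sub>1 :: "'w \<Rightarrow> 'a measure" and \<eta>\<^sub>2 :: "'v \<Rightarrow> 'a measure"
  assumes "prob_space M" and "prob_space N"
    and "mixed_sampled_point_process M F \<tau> X \<eta>\<^sub>1"
    and "in_class_S M \<tau>"
    and "poisson_point_process N (mean_measure M \<eta>\<^sub>1) \<eta>\<^sub>2"
  shows "dcx_le_pp M \<eta>\<^sub>1 N \<eta>\<^sub>2"
proof -
  interpret M: prob_space M by fact
  interpret N: prob_space N by fact
  note mixed = assms(3)[unfolded mixed_sampled_point_process_def]
  note poisson = assms(5)[unfolded poisson_point_process_def]
  have ind: "M.indep_vars (\<lambda>_. borel) X UNIV" and F: "\<And>i. distr M borel (X i) = F"
    and \<tau>: "\<tau> \<in> measurable M (count_space UNIV)" and \<eta>\<^sub>1: "\<eta>\<^sub>1 = sampled_process \<tau> X"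
    and ind\<tau>: "M.indep_set (sets (vimage_algebra (space M) \<tau> (count_space UNIV)))
       (sets (vimage_algebra (space M) (\<lambda>\<omega> i. X i \<omega>) (PiM UNIV (\<lambda>_. borel))))"
    using mixed by auto
  have X: "X i \<in> borel_measurable M" for i using ind by (auto simp: M.indep_vars_def)
  interpret F: prob_space F using M.prob_space_distr[OF X[of 0]] F[of 0] by simp
  have sets_F: "sets F = sets borel" and space_F: "space F = UNIV"
    using F[of 0] by (auto dest: arg_cong[where f = sets] arg_cong[where f = space])

  define p where "p k = M.prob {\<omega>\<in>space M. \<tau> \<omega> = k}" for k
  have p_nonneg: "0 \<le> p k" for k by (simp add: p_def)
  obtain P where "P \<in> class_S" and P: "distr M (count_space UNIV) \<tau> = measure_pmf P"
    using assms(4) by (auto simp: in_class_S_def)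
  have p_pmf: "p k = pmf P k" for k
  proof -
    have "pmf P k = measure (distr M (count_space UNIV) \<tau>) {k}" by (simp add: P measure_pmf_single)
    also have "\<dots> = M.prob (\<tau> -` {k} \<inter> space M)" by (rule measure_distr[OF \<tau>]) simp
    also have "\<tau> -` {k} \<inter> space M = {\<omega>\<in>space M. \<tau> \<omega> = k}" by auto
    finally show ?thesis by (simp add: p_def)
  qed
  have log_concave: "log_concave (\<lambda>k. fact k * p k)"
    unfolding p_pmf by (rule class_S_log_concave) fact
  have "(\<Sum>k. ennreal (p k)) = 1"
    unfolding p_pmf nn_integral_count_space_nat[symmetric] nn_integral_pmf
    using measure_pmf.emeasure_space_1[of P] by simp
  then have p_sums: "p sums 1"
    using sums_of_suminf_ennreal[of p] p_nonneg by simp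

  have \<Lambda>: "emeasure (mean_measure M \<eta>\<^sub>1) A = (\<Sum>k. ennreal (p k * (real k * measure F A)))" if "A \<in> sets borel" for A
    unfolding p_def by (rule M.emeasure_mean_measure_mixed_sampled[OF assms(3) that])
  (* The intensity is finite on bounded sets; on one that F charges, this bounds the mean of
     tau. *)
  obtain A where A: "A \<in> sets borel" "bounded A" "0 < measure F A"
    by (rule exists_bounded_positive[OF F.prob_space_axioms sets_F])
  have "(\<Sum>k. ennreal (p k * (real k * measure F A))) < top"
    using poisson A by (simp add: \<Lambda>[symmetric])
  then have "(\<lambda>k. p k * (real k * measure F A)) sums enn2real (\<Sum>k. ennreal (p k * (real k * measure F A)))"
    by (intro sums_of_suminf_ennreal) (simp_all add: p_nonneg)
  from sums_divide[OF this, of "measure F A"] obtain r where r: "(\<lambda>k. real k * p k) sums r"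
    using A by (auto simp: mult_ac)
  have "0 \<le> r" using sums_le[OF _ sums_zero r] p_nonneg by simp
  have \<Lambda>_eq: "emeasure (mean_measure M \<eta>\<^sub>1) B = ennreal (r * measure F B)" if "B \<in> sets borel" for B
    unfolding \<Lambda>[OF that] using sums_mult2[OF r, of "measure F B"]
    by (intro suminf_ennreal_eq) (simp_all add: p_nonneg mult_ac)

  show ?thesis
    unfolding dcx_le_pp_def
  proof (intro allI impI)
    fix n :: nat and B :: "nat \<Rightarrow> 'a set"
    assume "disjoint_bounded_borel n B"
    then have B: "\<And>i. i < n \<Longrightarrow> B i \<in> sets borel" "\<And>i. i < n \<Longrightarrow> bounded (B i)" "disjoint_family_on B {..<n}"
      by (auto simp: disjoint_bounded_borel_def)
    define C where "C = cell_index n B"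
    have C: "C \<in> measurable borel (count_space UNIV)" "\<And>x. C x < Suc n"
      unfolding C_def by (auto intro!: measurable_cell_index B simp: cell_index_less)
    have C_iff: "C x = i \<longleftrightarrow> x \<in> B i" if "i < n" for x i
      unfolding C_def by (rule cell_index_eq_iff[OF B(3) that])
    define w where "w i = measure F (C -` {i})" for i
    have w: "0 \<le> w i" for i by (simp add: w_def)
    have w_sum: "(\<Sum>i<Suc n. w i) = 1"
      unfolding w_def using C sets_F space_F
      by (intro sum_measure_cells[OF F.prob_space_axioms]) (auto cong: measurable_cong_sets)
    have w_B: "w i = measure F (B i)" if "i < n" for i
    proof -
      have "C -` {i} = B i" using C_iff[OF that] by auto
      then show ?thesis by (simp add: w_def)
    qed
    let ?T = "shift_avg w (Suc n)"

    define K where "K \<omega> = occupancy C (\<tau> \<omega>) (\<lambda>j. X j \<omega>)" for \<omega>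
    have K_law: "(\<integral>\<^sup>+\<omega>. ennreal (u (K \<omega>)) \<partial>M) = (\<Sum>k. ennreal (p k * (?T ^^ k) u (\<lambda>_. 0)))"
      if "\<And>x. 0 \<le> u x" for u
      unfolding K_def p_def w_def by (rule M.expectation_mixed_occupancy[OF ind F \<tau> ind\<tau> C that])
    have K_emeasure: "emeasure (\<eta>\<^sub>1 \<omega>) (B i) = of_nat (K \<omega> i)" if "i < n" for \<omega> i
      unfolding \<eta>\<^sub>1 emeasure_sampled_process[OF B(1)[OF that]] K_def occupancy_def C_iff[OF that] ..
    have count_M: "count_vector n B \<eta>\<^sub>1 \<omega> = real_vec n (K \<omega>)" for \<omega>
      by (auto simp: count_vector_def real_vec_def fun_eq_iff measure_def K_emeasure)

    (* The counts of the Poisson process are extended non-negative reals; D reads them as natural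
       numbers. *)
    define D where "D e = nat \<lfloor>enn2real e\<rfloor>" for e
    have D: "D \<in> measurable borel (count_space UNIV)" unfolding D_def by measurable
    have D_of_nat: "D (of_nat k) = k" for k by (simp add: D_def)
    define L where "L \<omega> i = (if i < n then D (emeasure (\<eta>\<^sub>2 \<omega>) (B i)) else 0)" for \<omega> i
    have counts_N: "\<forall>\<omega>\<in>space N. \<forall>B\<in>sets borel. bounded B \<longrightarrow> emeasure (\<eta>\<^sub>2 \<omega>) B \<in> range of_nat"
      using poisson by (simp add: point_process_def)
    have L_emeasure: "emeasure (\<eta>\<^sub>2 \<omega>) (B i) = of_nat (L \<omega> i)" if "\<omega> \<in> space N" "i < n" for \<omega> i
    proof -
      have "emeasure (\<eta>\<^sub>2 \<omega>) (B i) \<in> range of_nat"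
        using counts_N that B(1,2) by blast
      then show ?thesis using that by (auto simp: L_def D_of_nat)
    qed
    have count_N: "count_vector n B \<eta>\<^sub>2 \<omega> = real_vec n (L \<omega>)" if "\<omega> \<in> space N" for \<omega>
      using that by (auto simp: count_vector_def real_vec_def fun_eq_iff measure_def L_emeasure)
    have ind_N: "N.indep_vars (\<lambda>_. borel) (\<lambda>i \<omega>. emeasure (\<eta>\<^sub>2 \<omega>) (B i)) {..<n}"
      using poisson \<open>disjoint_bounded_borel n B\<close> by blast
    have law_N: "N.prob {\<omega>\<in>space N. D (emeasure (\<eta>\<^sub>2 \<omega>) (B i)) = k} = poisson_weight (r * w i) k" if "i < n" for i k
    proof -
      have "{\<omega>\<in>space N. D (emeasure (\<eta>\<^sub>2 \<omega>) (B i)) = k} = {\<omega>\<in>space N. emeasure (\<eta>\<^sub>2 \<omega>) (B i) = of_nat k}"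
        using L_emeasure[OF _ that] by (auto simp: D_of_nat)
      moreover have "measure (mean_measure M \<eta>\<^sub>1) (B i) = r * w i"
        using \<open>0 \<le> r\<close> that by (simp add: measure_def \<Lambda>_eq B w_B)
      ultimately show ?thesis using poisson B(1,2)[OF that] by (simp add: poisson_weight_def)
    qed
    have L_law: "(\<integral>\<^sup>+\<omega>. ennreal (u (L \<omega>)) \<partial>N) = (\<Sum>k. ennreal (poisson_weight r k * (?T ^^ k) u (\<lambda>_. 0)))"
      if u: "\<And>x. 0 \<le> u x" and ignore: "\<And>x j. u (x(n := j)) = u x" for u
      unfolding poisson_mixture_residual_cell[OF w w_sum \<open>0 \<le> r\<close> u ignore]
      using N.expectation_indep_poisson[OF ind_N D law_N w \<open>0 \<le> r\<close> u order_refl, where x = "\<lambda>_. 0"]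
      by (simp add: L_def[abs_def])

    have mean: "(\<Sum>k. ennreal (q k * (?T ^^ k) (\<lambda>x. real (x i)) (\<lambda>_. 0))) = ennreal (r * w i)"
      if "i < n" "\<And>k. 0 \<le> q k" "(\<lambda>k. real k * q k) sums r" for q i
    proof (rule suminf_ennreal_eq)
      have T: "(?T ^^ k) (\<lambda>x. real (x i)) (\<lambda>_. 0) = real k * w i" for k
        using shift_avg_iter_coordinate[OF w_sum less_SucI[OF \<open>i < n\<close>], of k "\<lambda>_. 0"] by simp
      show "0 \<le> q k * (?T ^^ k) (\<lambda>x. real (x i)) (\<lambda>_. 0)" for k
        unfolding T by (intro mult_nonneg_nonneg that w) simp
      show "(\<lambda>k. q k * (?T ^^ k) (\<lambda>x. real (x i)) (\<lambda>_. 0)) sums (r * w i)"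
        unfolding T using sums_mult2[OF that(3), of "w i"] by (simp only: mult_ac)
    qed
    have K_mean: "(\<integral>\<^sup>+\<omega>. ennreal (real (K \<omega> i)) \<partial>M) = ennreal (r * w i)" if "i < n" for i
      using K_law[of "\<lambda>x. real (x i)"] mean[OF that p_nonneg r] by simp
    have L_mean: "(\<integral>\<^sup>+\<omega>. ennreal (real (L \<omega> i)) \<partial>N) = ennreal (r * w i)" if "i < n" for i
      using that L_law[of "\<lambda>x. real (x i)"]
        mean[OF that poisson_weight_nonneg[OF \<open>0 \<le> r\<close>] poisson_weight_mean] by simp
    have K_meas: "(\<lambda>\<omega>. real (K \<omega> i)) \<in> borel_measurable M" if "i < n" for i
    proof -
      have "(\<lambda>\<omega>. emeasure (\<eta>\<^sub>1 \<omega>) (B i)) \<in> borel_measurable M"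
        unfolding \<eta>\<^sub>1 by (rule measurable_emeasure_sampled_process[OF B(1)[OF that] \<tau> X])
      then have "(\<lambda>\<omega>. enn2real (emeasure (\<eta>\<^sub>1 \<omega>) (B i))) \<in> borel_measurable M"
        by (rule borel_measurable_enn2real)
      then show ?thesis using that by (simp add: K_emeasure)
    qed
    have L_meas: "(\<lambda>\<omega>. real (L \<omega> i)) \<in> borel_measurable N" if "i < n" for i
    proof -
      have "(\<lambda>\<omega>. emeasure (\<eta>\<^sub>2 \<omega>) (B i)) \<in> borel_measurable N"
        using ind_N that by (auto simp: N.indep_vars_def)
      then have "(\<lambda>\<omega>. D (emeasure (\<eta>\<^sub>2 \<omega>) (B i))) \<in> measurable N (count_space UNIV)"
        by (rule measurable_compose[OF _ D])
      then have "(\<lambda>\<omega>. real (D (emeasure (\<eta>\<^sub>2 \<omega>) (B i)))) \<in> borel_measurable N"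
        by (rule measurable_compose) simp
      then show ?thesis using that by (simp add: L_def)
    qed

    show "dcx_le n M (count_vector n B \<eta>\<^sub>1) N (count_vector n B \<eta>\<^sub>2)"
      unfolding dcx_le_def
    proof (intro allI impI, elim conjE)
      fix f assume f: "directionally_convex n f"
        and exM: "expectation_exists M (\<lambda>\<omega>. f (count_vector n B \<eta>\<^sub>1 \<omega>))"
        and exN: "expectation_exists N (\<lambda>\<omega>. f (count_vector n B \<eta>\<^sub>2 \<omega>))"
      have fK: "(\<lambda>\<omega>. f (real_vec n (K \<omega>))) \<in> borel_measurable M"
        using exM by (simp add: expectation_exists_def count_M)
      have "(\<lambda>\<omega>. f (count_vector n B \<eta>\<^sub>2 \<omega>)) \<in> borel_measurable N"
        using exN by (simp add: expectation_exists_def)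
      then have fL: "(\<lambda>\<omega>. f (real_vec n (L \<omega>))) \<in> borel_measurable N"
        by (subst measurable_cong[of N _ "\<lambda>\<omega>. f (count_vector n B \<eta>\<^sub>2 \<omega>)"]) (simp_all add: count_N)
      (* Both expectations of f differ from those of u by the same finite amount. *)
      define u where "u x = f (real_vec n x) - tangent n f x" for x
      have u_nonneg: "0 \<le> u x" for x
        using directionally_convex_above_tangent[OF f] by (simp add: u_def)
      have u_ignore: "u (x(n := j)) = u x" for x j
      proof -
        have "real_vec n (x(n := j)) = real_vec n x" "tangent n f (x(n := j)) = tangent n f x"
          by (auto simp: real_vec_def tangent_def fun_eq_iff)
        then show ?thesis by (simp add: u_def)
      qed
      have u_dcx: "lattice_dcx (Suc n) u"
        using lattice_dcx_minus_tangent[OF f] by (simp add: u_def[abs_def])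
      have "(\<integral>\<^sup>+\<omega>. ennreal (u (K \<omega>)) \<partial>M) \<le> (\<integral>\<^sup>+\<omega>. ennreal (u (L \<omega>)) \<partial>N)"
        unfolding K_law[of u, OF u_nonneg] L_law[of u, OF u_nonneg u_ignore]
        by (intro log_concave_convex_le_poisson p_nonneg p_sums r log_concave
            shift_avg_iter_nonneg w u_nonneg shift_avg_iter_convex w_sum u_dcx)
      then have "enn2ereal (\<integral>\<^sup>+\<omega>. ennreal (u (K \<omega>)) \<partial>M) \<le> enn2ereal (\<integral>\<^sup>+\<omega>. ennreal (u (L \<omega>)) \<partial>N)"
        by (simp add: less_eq_ennreal.rep_eq)
      moreover have "ext_expectation N (\<lambda>\<omega>. f (count_vector n B \<eta>\<^sub>2 \<omega>)) = ext_expectation N (\<lambda>\<omega>. f (real_vec n (L \<omega>)))"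
        unfolding ext_expectation_def
        by (intro arg_cong2[where f = minus] arg_cong[where f = enn2ereal] nn_integral_cong) (simp_all add: count_N)
      moreover have rw: "0 \<le> r * w i" for i using \<open>0 \<le> r\<close> w by simp
      ultimately show "ext_expectation M (\<lambda>\<omega>. f (count_vector n B \<eta>\<^sub>1 \<omega>)) \<le> ext_expectation N (\<lambda>\<omega>. f (count_vector n B \<eta>\<^sub>2 \<omega>))"
        unfolding count_M
        by (simp only: M.ext_expectation_directionally_convex[OF f fK K_meas K_mean rw]
          N.ext_expectation_directionally_convex[OF f fL L_meas L_mean rw] u_def add_right_mono)
    qed
  qed
qed

end
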